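(* For every integer $k\ge1$ there is $n_0$ such that for every $n\ge n_0$ there is a non-negative normal element $\Sigma\in\mathbb{R}[S_n]$ with $$\max\left(\lambda(k,\Sigma),\lambda^{\mathrm{sgn}}(k,\Sigma)\right)<\lambda(S_n,\Sigma).$$
   Context: An element $\Sigma=\sum_{\sigma\in S_n}\alpha_\sigma\sigma\in\mathbb{R}[S_n]$ is non-negative if $\alpha_\sigma\ge0$ for all $\sigma$, symmetric if $\alpha_\sigma=\alpha_{\sigma^{-1}}$ for all $\sigma$, and normal if $\sigma\mapsto\alpha_\sigma$ is constant on each conjugacy class (normal elements of $\mathbb{R}[S_n]$ are symmetric). For a representation $\rho$ of $S_n$ put $\rho(\Sigma)=\sum_\sigma\alpha_\sigma\rho(\sigma)$. $\widehat{S_n}$ is the set of complex irreducible representations of $S_n$, with $\mathrm{triv}$ and $\mathrm{sgn}$ the trivial and sign representations. For symmetric $\Sigma$ all eigenvalues of $\rho(\Sigma)$ are real; $\lambda_1(\rho(\Sigma))$ denotes the largest one, and $$\lambda(S_n,\Sigma)=\max_{\rho\in\widehat{S_n}\setminus\{\mathrm{triv},\mathrm{sgn}\}}\lambda_1(\rho(\Sigma)).$$ Let $[n]_k$ be the set of ordered $k$-tuples of distinct elements of $\{1,\dots,n\}$ ($k<n$), with the natural action of $S_n$, and let $\rho_{[n]_k}(\sigma)$ be the permutation matrix of $\sigma$ acting on $[n]_k$. Put $$\rho_{[n]_k}(\Sigma)=\sum_\sigma\alpha_\sigma\rho_{[n]_k}(\sigma),\qquad \rho^{\mathrm{sgn}}_{[n]_k}(\Sigma)=\sum_\sigma\mathrm{sgn}(\sigma)\alpha_\sigma\rho_{[n]_k}(\sigma).$$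 Then $\lambda(k,\Sigma)$ (resp. $\lambda^{\mathrm{sgn}}(k,\Sigma)$) is the largest eigenvalue of $\rho_{[n]_k}(\Sigma)$ (resp. $\rho^{\mathrm{sgn}}_{[n]_k}(\Sigma)$) having an eigenvector orthogonal to the constant functions on $[n]_k$. *)

theory Defs
  imports
    "HOL-Algebra.Sym_Groups"
    "Jordan_Normal_Form.Char_Poly"
    "Jordan_Normal_Form.VS_Connect"
begin

text \<open>
  An element of \<open>\<real>[S\<^sub>n]\<close> is given by its coefficient function \<open>\<alpha> :: (nat \<Rightarrow> nat) \<Rightarrow> real\<close>;
  only its values on \<open>carrier (sym_group n)\<close> are ever used.
\<close>

definition nonneg_elem :: "nat \<Rightarrow> ((nat \<Rightarrow> nat) \<Rightarrow> real) \<Rightarrow> bool" where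
  "nonneg_elem n \<alpha> \<longleftrightarrow> (\<forall>\<sigma> \<in> carrier (sym_group n). 0 \<le> \<alpha> \<sigma>)"

definition normal_elem :: "nat \<Rightarrow> ((nat \<Rightarrow> nat) \<Rightarrow> real) \<Rightarrow> bool" where
  "normal_elem n \<alpha> \<longleftrightarrow>
     (\<forall>\<sigma> \<in> carrier (sym_group n). \<forall>\<tau> \<in> carrier (sym_group n).
        \<alpha> (\<tau> \<otimes>\<^bsub>sym_group n\<^esub> \<sigma> \<otimes>\<^bsub>sym_group n\<^esub> inv\<^bsub>sym_group n\<^esub> \<tau>) = \<alpha> \<sigma>)"

text \<open>A complex representation of dimension \<open>d\<close> is a homomorphism into \<open>GL\<^sub>d(\<complex>)\<close>.\<close>

definition representation :: "nat \<Rightarrow> nat \<Rightarrow> ((nat \<Rightarrow> nat) \<Rightarrow> complex mat) \<Rightarrow> bool" where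
  "representation n d \<rho> \<longleftrightarrow> \<rho> \<in> hom (sym_group n) (units_of (ring_mat TYPE(complex) d ()))"

definition irreducible_rep :: "nat \<Rightarrow> nat \<Rightarrow> ((nat \<Rightarrow> nat) \<Rightarrow> complex mat) \<Rightarrow> bool" where
  "irreducible_rep n d \<rho> \<longleftrightarrow>
     representation n d \<rho> \<and> 0 < d \<and>
     (\<forall>W. VectorSpace.subspace class_ring W (module_vec TYPE(complex) d) \<longrightarrow>
          (\<forall>\<sigma> \<in> carrier (sym_group n). \<forall>w \<in> W. \<rho> \<sigma> *\<^sub>v w \<in> W) \<longrightarrow>
          W = {0\<^sub>v d} \<or> W = carrier_vec d)"

definition equivalent_rep ::
  "nat \<Rightarrow> ((nat \<Rightarrow> nat) \<Rightarrow> complex mat) \<Rightarrow> ((nat \<Rightarrow> nat) \<Rightarrow> complex mat) \<Rightarrow> bool" where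
  "equivalent_rep n \<rho> \<rho>' \<longleftrightarrow>
     (\<exists>P Q. \<forall>\<sigma> \<in> carrier (sym_group n). similar_mat_wit (\<rho> \<sigma>) (\<rho>' \<sigma>) P Q)"

definition triv_rep :: "(nat \<Rightarrow> nat) \<Rightarrow> complex mat" where
  "triv_rep \<sigma> = 1\<^sub>m 1"

definition sgn_rep :: "(nat \<Rightarrow> nat) \<Rightarrow> complex mat" where
  "sgn_rep \<sigma> = of_int (sign \<sigma>) \<cdot>\<^sub>m 1\<^sub>m 1"

text \<open>The matrix \<open>\<rho>(\<Sigma>) = \<Sum>\<^sub>\<sigma> \<alpha>\<^sub>\<sigma> \<rho>(\<sigma>)\<close>, written entrywise.\<close>

definition rep_elem ::
  "nat \<Rightarrow> nat \<Rightarrow> ((nat \<Rightarrow> nat) \<Rightarrow> complex mat) \<Rightarrow> ((nat \<Rightarrow> nat) \<Rightarrow> real) \<Rightarrow> complex mat" where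
  "rep_elem n d \<rho> \<alpha> =
     mat d d (\<lambda>(i, j). \<Sum>\<sigma> \<in> carrier (sym_group n). complex_of_real (\<alpha> \<sigma>) * \<rho> \<sigma> $$ (i, j))"

text \<open>
  The maxima below are meaningful for symmetric (in particular for normal) \<open>\<alpha>\<close>, for which all
  eigenvalues in question are real.
\<close>

definition lambda1 :: "complex mat \<Rightarrow> real" where
  "lambda1 A = Max {c :: real. eigenvalue A (complex_of_real c)}"

text \<open>
  Instead of one representative per isomorphism class, all irreducible matrix representations not
  equivalent to the two excluded ones are ranged over; \<open>lambda1\<close> is invariant under equivalence,
  so the set of values is the same (and finite).
\<close>

definition lambda_Sn :: "nat \<Rightarrow> ((nat \<Rightarrow> nat) \<Rightarrow> real) \<Rightarrow> real" where
  "lambda_Sn n \<alpha> =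
     Max {lambda1 (rep_elem n d \<rho> \<alpha>) | d \<rho>.
            irreducible_rep n d \<rho> \<and> \<not> equivalent_rep n \<rho> triv_rep \<and> \<not> equivalent_rep n \<rho> sgn_rep}"

definition tuples :: "nat \<Rightarrow> nat \<Rightarrow> nat list set" where
  "tuples n k = {xs. length xs = k \<and> distinct xs \<and> set xs \<subseteq> {1..n}}"

text \<open>
  Matrices with rows and columns indexed by \<open>tuples n k\<close> are functions of two tuples. The entry of
  the permutation matrix is \<open>1\<close> at \<open>(\<sigma> y, y)\<close>, so that \<open>\<sigma> \<mapsto> perm_matrix \<sigma>\<close> is multiplicative.
\<close>

definition perm_matrix :: "(nat \<Rightarrow> nat) \<Rightarrow> nat list \<Rightarrow> nat list \<Rightarrow> real" where
  "perm_matrix \<sigma> x y = (if x = map \<sigma> y then 1 else 0)"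

definition rho_tuples ::
  "nat \<Rightarrow> ((nat \<Rightarrow> nat) \<Rightarrow> real) \<Rightarrow> nat list \<Rightarrow> nat list \<Rightarrow> real" where
  "rho_tuples n \<alpha> x y = (\<Sum>\<sigma> \<in> carrier (sym_group n). \<alpha> \<sigma> * perm_matrix \<sigma> x y)"

definition rho_sgn_tuples ::
  "nat \<Rightarrow> ((nat \<Rightarrow> nat) \<Rightarrow> real) \<Rightarrow> nat list \<Rightarrow> nat list \<Rightarrow> real" where
  "rho_sgn_tuples n \<alpha> x y =
     (\<Sum>\<sigma> \<in> carrier (sym_group n). real_of_int (sign \<sigma>) * \<alpha> \<sigma> * perm_matrix \<sigma> x y)"

definition eigenfun :: "'x set \<Rightarrow> ('x \<Rightarrow> 'x \<Rightarrow> real) \<Rightarrow> ('x \<Rightarrow> real) \<Rightarrow> real \<Rightarrow> bool" where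
  "eigenfun X M f c \<longleftrightarrow> (\<exists>x \<in> X. f x \<noteq> 0) \<and> (\<forall>x \<in> X. (\<Sum>y \<in> X. M x y * f y) = c * f x)"

definition max_eigenvalue_orth_const :: "'x set \<Rightarrow> ('x \<Rightarrow> 'x \<Rightarrow> real) \<Rightarrow> real" where
  "max_eigenvalue_orth_const X M = Max {c. \<exists>f. eigenfun X M f c \<and> (\<Sum>x \<in> X. f x) = 0}"

definition lambda_tuples :: "nat \<Rightarrow> nat \<Rightarrow> ((nat \<Rightarrow> nat) \<Rightarrow> real) \<Rightarrow> real" where
  "lambda_tuples n k \<alpha> = max_eigenvalue_orth_const (tuples n k) (rho_tuples n \<alpha>)"

definition lambda_sgn_tuples :: "nat \<Rightarrow> nat \<Rightarrow> ((nat \<Rightarrow> nat) \<Rightarrow> real) \<Rightarrow> real" where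
  "lambda_sgn_tuples n k \<alpha> = max_eigenvalue_orth_const (tuples n k) (rho_sgn_tuples n \<alpha>)"

end

theory Submission
  imports Defs "Jordan_Normal_Form.Schur_Decomposition"
begin

text \<open>
  Take \<open>\<alpha> = M \<cdot> 1\<^bsub>A\<^sub>n\<^esub> + f\<close>, where \<open>f\<close> is a nonzero class function supported on even permutations
  with \<open>\<rho>\<^bsub>[n]\<^sub>k\<^esub>(f) = 0\<close>, and \<open>M\<close> is large enough to make \<open>\<alpha>\<close> non-negative. Then \<open>\<rho>\<^bsub>[n]\<^sub>k\<^esub>(\<alpha>)\<close> is
  a constant matrix and equals its sign-twisted version, so both eigenvalues on the left are \<open>0\<close>.

  Such an \<open>f\<close> exists by counting: an entry \<open>(x, y)\<close> of \<open>\<rho>\<^bsub>[n]\<^sub>k\<^esub>(f)\<close> depends only on which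
  coordinates of \<open>x\<close> and \<open>y\<close> coincide, so there are at most \<open>2\<close> to the power \<open>k\<^sup>2\<close> linear conditions, while
  already the functions of the number of moved points have dimension growing with \<open>n\<close>.

  As \<open>f\<close> is symmetric and nonzero, it has a nonzero real eigenvalue \<open>c\<close> on the regular
  representation, and \<open>c > 0\<close> after a change of sign. A representation of minimal positive dimension on
  which \<open>f\<close> acts as the scalar \<open>c\<close> is irreducible. It is neither trivial nor sign because the
  coefficients of \<open>f\<close> sum to \<open>0\<close>, and for the same reason \<open>1\<^bsub>A\<^sub>n\<^esub>\<close> acts on it as \<open>0\<close>; hence
  \<open>\<alpha>\<close> acts as \<open>c\<close>.
\<close>

section \<open>Linear algebra\<close>

text \<open>Gaussian elimination, one equation at a time: if the equation \<open>q\<close> is not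
  vacuous, a pivot \<open>i0\<close> is removed from the unknowns together with it, and the count
  stays strict. Arbitrary finite index sets allow equations indexed by rows of a matrix as well as
  by patterns of tuples.\<close>

lemma exists_nontrivial_relation:
  fixes g :: "'i \<Rightarrow> 'p \<Rightarrow> 'a::field"
  assumes "finite P" "finite I" "card P < card I"
  shows "\<exists>c. (\<exists>i\<in>I. c i \<noteq> 0) \<and> (\<forall>p\<in>P. (\<Sum>i\<in>I. c i * g i p) = 0)"
  using assms
proof (induction P arbitrary: I g rule: finite_induct)
  case empty
  then have "I \<noteq> {}" by auto
  then show ?case by (intro exI[of _ "\<lambda>_. 1"]) auto
next
  case (insert q P)
  show ?case
  proof (cases "\<forall>i\<in>I. g i q = 0")
    case True
    from insert.IH[of I g] insert.prems insert.hyps obtain c where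
      "\<exists>i\<in>I. c i \<noteq> 0" "\<forall>p\<in>P. (\<Sum>i\<in>I. c i * g i p) = 0" by auto
    with True show ?thesis by (intro exI[of _ c]) (auto intro: sum.neutral)
  next
    case False
    then obtain i0 where i0: "i0 \<in> I" "g i0 q \<noteq> 0" by auto
    let ?J = "I - {i0}"
    \<comment> \<open>The coefficients after the elimination of \<open>i0\<close>; those of the
      equation \<open>q\<close> become zero.\<close>
    let ?h = "\<lambda>i p. g i p - g i q / g i0 q * g i0 p"
    have "card P < card ?J" using insert i0 by simp
    with insert.IH[of ?J ?h] insert.prems obtain c where
      c: "\<exists>i\<in>?J. c i \<noteq> 0" "\<forall>p\<in>P. (\<Sum>i\<in>?J. c i * ?h i p) = 0" by auto
    \<comment> \<open>The value at \<open>i0\<close> is the one that the equation \<open>q\<close>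
      forces.\<close>
    define e where "e = (\<lambda>i. if i = i0 then - (\<Sum>i\<in>?J. c i * g i q) / g i0 q else c i)"
    have sum_e: "(\<Sum>i\<in>I. e i * g i p) = (\<Sum>i\<in>?J. c i * ?h i p)" for p
    proof -
      have "(\<Sum>i\<in>I. e i * g i p) = e i0 * g i0 p + (\<Sum>i\<in>?J. e i * g i p)"
        using insert.prems i0 by (simp add: sum.remove)
      also have "(\<Sum>i\<in>?J. e i * g i p) = (\<Sum>i\<in>?J. c i * g i p)"
        by (intro sum.cong) (auto simp: e_def)
      also have "e i0 * g i0 p = - (\<Sum>i\<in>?J. c i * (g i q / g i0 q * g i0 p))"
        by (simp add: e_def sum_distrib_right sum_divide_distrib mult.assoc)
      finally show ?thesis
        by (simp add: right_diff_distrib sum_subtractf)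
    qed
    have "(\<Sum>i\<in>I. e i * g i q) = 0" unfolding sum_e using i0 by simp
    moreover have "\<exists>i\<in>I. e i \<noteq> 0" using c(1) by (auto simp: e_def)
    ultimately show ?thesis using c(2) sum_e by (intro exI[of _ e]) auto
  qed
qed

section \<open>Injective matrices as bases of subspaces\<close>

text \<open>The columns of such a \<open>B\<close> are linearly independent, so \<open>B\<close>
  stands for a basis of its range, with coordinates in \<open>carrier_vec m\<close>.\<close>

definition inj_mat :: "nat \<Rightarrow> nat \<Rightarrow> 'a::field mat \<Rightarrow> bool" where
  "inj_mat d m B \<longleftrightarrow>
     B \<in> carrier_mat d m \<and> (\<forall>v\<in>carrier_vec m. B *\<^sub>v v = 0\<^sub>v d \<longrightarrow> v = 0\<^sub>v m)"

text \<open>With more columns than rows there would be a nontrivial relation between the columns,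
  and its coefficients form a nonzero kernel vector.\<close>

lemma inj_mat_le:
  fixes B :: "'a::field mat"
  assumes "inj_mat d m B"
  shows "m \<le> d"
proof (rule ccontr)
  assume "\<not> m \<le> d"
  then obtain c :: "nat \<Rightarrow> 'a" where c: "\<exists>j\<in>{0..<m}. c j \<noteq> 0"
    "\<forall>i\<in>{0..<d}. (\<Sum>j\<in>{0..<m}. c j * B $$ (i, j)) = 0"
    using exists_nontrivial_relation[of "{0..<d}" "{0..<m}" "\<lambda>j i. B $$ (i, j)"] by auto
  have "B *\<^sub>v vec m c = 0\<^sub>v d"
    using c(2) assms by (intro eq_vecI) (auto simp: inj_mat_def scalar_prod_def mult.commute)
  then have "vec m c = 0\<^sub>v m" using assms by (auto simp: inj_mat_def)
  then have "c j = 0" if "j < m" for j using that by (metis index_vec index_zero_vec(1))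
  with c(1) show False by auto
qed

lemma inj_mat_cancel_vec:
  assumes "inj_mat d m B" "x \<in> carrier_vec m" "y \<in> carrier_vec m" "B *\<^sub>v x = B *\<^sub>v y"
  shows "x = y"
proof -
  have B: "B \<in> carrier_mat d m" using assms(1) by (simp add: inj_mat_def)
  have "B *\<^sub>v (x - y) = 0\<^sub>v d"
    using assms(2-4) B by (simp add: mult_minus_distrib_mat_vec)
  then have "x - y = 0\<^sub>v m" using assms unfolding inj_mat_def by auto
  then have "x $ i - y $ i = 0" if "i < m" for i
    using that assms(2,3) by (metis carrier_vecD index_minus_vec(1) index_zero_vec(1))
  then show ?thesis using assms(2,3) by (intro eq_vecI) auto
qed

lemma inj_mat_cancel:
  assumes "inj_mat d m B" "X \<in> carrier_mat m l" "Y \<in> carrier_mat m l" "B * X = B * Y"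
  shows "X = Y"
proof (rule mat_col_eqI)
  fix j assume "j < dim_col Y"
  then have j: "j < l" using assms by auto
  have B: "B \<in> carrier_mat d m" using assms(1) by (simp add: inj_mat_def)
  have "B *\<^sub>v col X j = col (B * X) j" using col_mult2[OF B assms(2) j] by simp
  also have "\<dots> = B *\<^sub>v col Y j" unfolding assms(4) using col_mult2[OF B assms(3) j] by simp
  finally show "col X j = col Y j"
    using inj_mat_cancel_vec[OF assms(1)] j assms(2,3) by (metis col_carrier_vec)
qed (use assms in auto)

definition append_col :: "nat \<Rightarrow> nat \<Rightarrow> 'a::field mat \<Rightarrow> 'a vec \<Rightarrow> 'a mat" where
  "append_col d m B w = mat d (Suc m) (\<lambda>(i, j). if j < m then B $$ (i, j) else w $ i)"

lemma append_col_mult: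
  assumes "B \<in> carrier_mat d m" "w \<in> carrier_vec d" "v \<in> carrier_vec (Suc m)"
  shows "append_col d m B w *\<^sub>v v = B *\<^sub>v vec m (\<lambda>j. v $ j) + v $ m \<cdot>\<^sub>v w"
  using assms by (intro eq_vecI) (auto simp: append_col_def scalar_prod_def mult.commute)

text \<open>If \<open>w\<close> had a nonzero coefficient in a kernel vector, dividing by this
  coefficient would put \<open>w\<close> into the range of \<open>B\<close>.\<close>

lemma inj_mat_append_col:
  assumes inj: "inj_mat d m B" and w: "w \<in> carrier_vec d"
    and nr: "\<And>v. v \<in> carrier_vec m \<Longrightarrow> B *\<^sub>v v \<noteq> w"
  shows "inj_mat d (Suc m) (append_col d m B w)"
  unfolding inj_mat_def
proof (intro conjI ballI impI)
  have B: "B \<in> carrier_mat d m" using inj by (simp add: inj_mat_def)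
  show "append_col d m B w \<in> carrier_mat d (Suc m)" by (simp add: append_col_def)
  fix v assume v: "v \<in> carrier_vec (Suc m)" and "append_col d m B w *\<^sub>v v = 0\<^sub>v d"
  then have eq: "B *\<^sub>v vec m (\<lambda>j. v $ j) + v $ m \<cdot>\<^sub>v w = 0\<^sub>v d"
    using append_col_mult[OF B w v] by simp
  have eqi: "(B *\<^sub>v vec m (\<lambda>j. v $ j)) $ i + v $ m * w $ i = 0" if "i < d" for i
    using arg_cong[OF eq, of "\<lambda>x. x $ i"] that B w by simp
  have vm: "v $ m = 0"
  proof (rule ccontr)
    assume vm: "v $ m \<noteq> 0"
    have "B *\<^sub>v (- inverse (v $ m) \<cdot>\<^sub>v vec m (\<lambda>j. v $ j))
      = - inverse (v $ m) \<cdot>\<^sub>v (B *\<^sub>v vec m (\<lambda>j. v $ j))"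
      using B by (intro mult_mat_vec) auto
    also have "\<dots> = w"
    proof (rule eq_vecI)
      fix i assume "i < dim_vec w"
      then have i: "i < d" using w by simp
      have "(B *\<^sub>v vec m (\<lambda>j. v $ j)) $ i = - (v $ m * w $ i)"
        using eqi[OF i] by (simp add: add_eq_0_iff2)
      then show "(- inverse (v $ m) \<cdot>\<^sub>v (B *\<^sub>v vec m (\<lambda>j. v $ j))) $ i = w $ i"
        using i B vm by simp
    qed (use B w in auto)
    finally show False using nr by (metis smult_carrier_vec vec_carrier)
  qed
  have "B *\<^sub>v vec m (\<lambda>j. v $ j) = 0\<^sub>v d"
    using eqi vm B by (intro eq_vecI) auto
  then have "vec m (\<lambda>j. v $ j) = 0\<^sub>v m" using inj by (auto simp: inj_mat_def)
  then have "v $ j = 0" if "j < m" for j using that by (metis index_vec index_zero_vec(1))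
  with vm have "v $ j = 0" if "j < Suc m" for j using that less_Suc_eq by auto
  then show "v = 0\<^sub>v (Suc m)" using v by (intro eq_vecI) auto
qed

lemma bounded_nat_max:
  assumes "P (k::nat)" "\<And>l. P l \<Longrightarrow> l \<le> b"
  obtains m where "P m" "\<And>l. P l \<Longrightarrow> l \<le> m"
  using GreatestI_nat[of P k b] Greatest_le_nat[of P _ b] assms by blast

text \<open>Among the injective matrices with range inside \<open>W\<close>, one with the most
  columns has range \<open>W\<close>, because a missed vector could be appended. The two conditional
  bounds later give an eigenspace positive dimension and a proper invariant subspace a smaller
  dimension.\<close>

lemma basis_mat_exists:
  fixes W :: "'a::field vec set"
  assumes sub: "W \<subseteq> carrier_vec d" and zero: "0\<^sub>v d \<in> W"
    and add: "\<And>v w. v \<in> W \<Longrightarrow> w \<in> W \<Longrightarrow> v + w \<in> W"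
    and smult: "\<And>c w. w \<in> W \<Longrightarrow> c \<cdot>\<^sub>v w \<in> W"
  obtains m B where "inj_mat d m B" "(\<lambda>v. B *\<^sub>v v) ` carrier_vec m = W"
    "W \<noteq> {0\<^sub>v d} \<Longrightarrow> 0 < m" "W \<noteq> carrier_vec d \<Longrightarrow> m < d"
proof -
  define P where "P m \<longleftrightarrow> (\<exists>B. inj_mat d m B \<and> (\<lambda>v. B *\<^sub>v v) ` carrier_vec m \<subseteq> W)" for m
  have "P 0" unfolding P_def
  proof (intro exI conjI)
    have "0\<^sub>m d 0 *\<^sub>v v = (0\<^sub>v d :: 'a vec)" if "v \<in> carrier_vec 0" for v
      using that by (intro eq_vecI) (auto simp: scalar_prod_def)
    then show "(\<lambda>v. 0\<^sub>m d 0 *\<^sub>v v) ` carrier_vec 0 \<subseteq> W" using zero by auto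
    show "inj_mat d 0 (0\<^sub>m d 0 :: 'a mat)" by (auto simp: inj_mat_def)
  qed
  moreover have "m \<le> d" if "P m" for m using that inj_mat_le unfolding P_def by blast
  ultimately obtain m where m: "P m" "\<And>l. P l \<Longrightarrow> l \<le> m"
    using bounded_nat_max[of P 0 d] by blast
  then obtain B where inj: "inj_mat d m B" and ran: "(\<lambda>v. B *\<^sub>v v) ` carrier_vec m \<subseteq> W"
    unfolding P_def by auto
  have B: "B \<in> carrier_mat d m" using inj by (simp add: inj_mat_def)
  have W: "(\<lambda>v. B *\<^sub>v v) ` carrier_vec m = W"
  proof (rule ccontr)
    assume "(\<lambda>v. B *\<^sub>v v) ` carrier_vec m \<noteq> W"
    with ran obtain w where w: "w \<in> W" "w \<notin> (\<lambda>v. B *\<^sub>v v) ` carrier_vec m" by auto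
    have wd: "w \<in> carrier_vec d" using w sub by auto
    have "inj_mat d (Suc m) (append_col d m B w)"
      using w by (intro inj_mat_append_col inj wd) auto
    moreover have "append_col d m B w *\<^sub>v v \<in> W" if "v \<in> carrier_vec (Suc m)" for v
      unfolding append_col_mult[OF B wd that] using ran w(1) by (intro add smult) auto
    ultimately have "P (Suc m)" unfolding P_def by (auto simp: image_subset_iff)
    from m(2)[OF this] show False by simp
  qed
  have m0: "0 < m" if ne: "W \<noteq> {0\<^sub>v d}"
  proof (rule ccontr)
    assume "\<not> 0 < m"
    with B have "B *\<^sub>v v = 0\<^sub>v d" if "v \<in> carrier_vec m" for v
      using that by (intro eq_vecI) (auto simp: scalar_prod_def)
    with W ne show False using zero by auto
  qed
  \<comment> \<open>A vector outside \<open>W\<close> can still be appended, so \<open>m + 1\<close>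
    independent columns fit into dimension \<open>d\<close>.\<close>
  have md: "m < d" if "W \<noteq> carrier_vec d"
  proof -
    from that sub obtain w where w: "w \<in> carrier_vec d" "w \<notin> W" by auto
    have "inj_mat d (Suc m) (append_col d m B w)"
      using w W by (intro inj_mat_append_col inj) auto
    from inj_mat_le[OF this] show ?thesis by simp
  qed
  from inj W m0 md show ?thesis by (rule that)
qed

section \<open>Traces and real symmetric matrices\<close>

definition trace_mat :: "'a::comm_ring_1 mat \<Rightarrow> 'a" where
  "trace_mat A = (\<Sum>i<dim_row A. A $$ (i, i))"

lemma trace_mat_mult_commute:
  assumes "A \<in> carrier_mat n m" "B \<in> carrier_mat m n"
  shows "trace_mat (A * B) = trace_mat (B * A)"
proof -
  have "trace_mat (A * B) = (\<Sum>i<n. \<Sum>j<m. A $$ (i, j) * B $$ (j, i))"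
    using assms by (auto simp: trace_mat_def scalar_prod_def lessThan_atLeast0)
  also have "\<dots> = (\<Sum>j<m. \<Sum>i<n. B $$ (j, i) * A $$ (i, j))"
    by (subst sum.swap) (simp add: mult.commute)
  also have "\<dots> = trace_mat (B * A)"
    using assms by (auto simp: trace_mat_def scalar_prod_def lessThan_atLeast0)
  finally show ?thesis .
qed

lemma trace_mat_similar:
  assumes "similar_mat_wit A B P Q"
  shows "trace_mat A = trace_mat B"
proof -
  define n where "n = dim_row A"
  note w = similar_mat_witD[OF n_def assms]
  have "trace_mat A = trace_mat (Q * (P * B))"
    using w trace_mat_mult_commute[of "P * B" n n Q] by simp
  also have "Q * (P * B) = B" using w assoc_mult_mat[of Q n n P n B n] by simp
  finally show ?thesis .
qed

text \<open>The trace of \<open>A * A\<close> is the sum of the squares of the entries, hence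
  positive. A triangular form of \<open>A\<close> turns the same trace into the sum of the squares
  of the eigenvalues, so one of these is nonzero, and symmetry makes it real.\<close>

lemma symmetric_nonzero_real_eigenvalue:
  fixes a :: "nat \<Rightarrow> nat \<Rightarrow> real"
  assumes sym: "\<And>i j. i < n \<Longrightarrow> j < n \<Longrightarrow> a i j = a j i"
    and nz: "i0 < n" "j0 < n" "a i0 j0 \<noteq> 0"
  obtains c :: real where "c \<noteq> 0"
    "eigenvalue (mat n n (\<lambda>(i, j). complex_of_real (a i j))) (complex_of_real c)"
proof -
  define A where "A = mat n n (\<lambda>(i, j). complex_of_real (a i j))"
  have A: "A \<in> carrier_mat n n" by (simp add: A_def)
  obtain es where es: "char_poly A = (\<Prod>e\<leftarrow>es. [:- e, 1:])"
    using char_poly_factorized[OF A] by auto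
  obtain B P Q where schur: "schur_decomposition A es = (B, P, Q)" by (metis prod_cases3)
  from schur_decomposition[OF A es schur]
  have B: "similar_mat_wit A B P Q" "upper_triangular B" "diag_mat B = es" by auto
  note w = similar_mat_witD2[OF A B(1)]
  have tr: "trace_mat (A * A) = trace_mat (B * B)"
  proof -
    have "similar_mat_wit (A ^\<^sub>m 2) (B ^\<^sub>m 2) P Q" by (rule similar_mat_wit_pow[OF B(1)])
    from trace_mat_similar[OF this] show ?thesis using A w by (simp add: numeral_2_eq_2)
  qed
  have "trace_mat (A * A) = complex_of_real (\<Sum>i<n. \<Sum>j<n. (a i j)\<^sup>2)"
    using sym by (auto simp: trace_mat_def A_def scalar_prod_def lessThan_atLeast0 power2_eq_square
        intro!: sum.cong)
  moreover have "(\<Sum>i<n. \<Sum>j<n. (a i j)\<^sup>2) > 0"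
  proof (rule sum_pos2[of _ i0])
    show "0 < (\<Sum>j<n. (a i0 j)\<^sup>2)" using nz by (intro sum_pos2[of _ j0]) auto
  qed (use nz in \<open>auto intro: sum_nonneg\<close>)
  ultimately have "trace_mat (B * B) \<noteq> 0" unfolding tr by (metis less_irrefl of_real_eq_0_iff)
  then obtain i where i: "i < n" "(B * B) $$ (i, i) \<noteq> 0"
    using w unfolding trace_mat_def
    by (metis (no_types, lifting) carrier_matD(1) index_mult_mat(2) lessThan_iff sum.neutral)
  have "(B * B) $$ (i, i) = (\<Sum>j = 0..<n. B $$ (i, j) * B $$ (j, i))"
    using i w by (simp add: scalar_prod_def)
  \<comment> \<open>For \<open>j \<noteq> i\<close> one of \<open>B $$ (i, j)\<close> and
    \<open>B $$ (j, i)\<close> lies below the diagonal.\<close>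
  also have "\<dots> = (\<Sum>j = 0..<n. if j = i then B $$ (i, i) * B $$ (i, i) else 0)"
    using upper_triangularD[OF B(2)] i w
    by (intro sum.cong refl) (metis atLeastLessThan_iff carrier_matD(1) mult_eq_0_iff linorder_neqE_nat)
  finally have nz_i: "B $$ (i, i) \<noteq> 0" using i by auto
  define z where "z = B $$ (i, i)"
  have "z \<in> set (diag_mat B)" using i w by (auto simp: diag_mat_def z_def)
  then have ev: "eigenvalue A z"
    unfolding eigenvalue_root_char_poly[OF A] es B(3) poly_prod_list prod_list_zero_iff by auto
  then obtain v where v: "v \<in> carrier_vec n" "v \<noteq> 0\<^sub>v n" "A *\<^sub>v v = z \<cdot>\<^sub>v v"
    using A by (auto simp: eigenvalue_def eigenvector_def)
  \<comment> \<open>The Hermitian form of \<open>A\<close> at \<open>v\<close>. It equals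
    \<open>z\<close> times the squared norm of \<open>v\<close>, and it is its own conjugate because
    \<open>a\<close> is real and symmetric.\<close>
  define q where "q = (\<Sum>i<n. \<Sum>j<n. cnj (v $ i) * complex_of_real (a i j) * v $ j)"
  have row: "(\<Sum>j<n. complex_of_real (a i j) * v $ j) = z * v $ i" if "i < n" for i
    using arg_cong[OF v(3), of "\<lambda>x. x $ i"] that v(1)
    by (simp add: A_def scalar_prod_def lessThan_atLeast0)
  have "q = (\<Sum>i<n. cnj (v $ i) * (\<Sum>j<n. complex_of_real (a i j) * v $ j))"
    by (simp add: q_def sum_distrib_left mult.assoc)
  also have "\<dots> = (\<Sum>i<n. z * (v $ i * cnj (v $ i)))"
    by (intro sum.cong) (auto simp: row)
  also have "\<dots> = z * complex_of_real (\<Sum>i<n. (cmod (v $ i))\<^sup>2)"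
    by (simp add: sum_distrib_left flip: complex_norm_square)
  finally have q: "q = z * complex_of_real (\<Sum>i<n. (cmod (v $ i))\<^sup>2)" .
  have "cnj q = (\<Sum>i<n. \<Sum>j<n. v $ i * complex_of_real (a i j) * cnj (v $ j))"
    by (simp add: q_def)
  also have "\<dots> = q"
    unfolding q_def using sym by (subst sum.swap) (auto intro!: sum.cong)
  finally have "cnj q = q" .
  moreover obtain l where l: "l < n" "v $ l \<noteq> 0" using v(1,2) by (metis carrier_vecD eq_vecI index_zero_vec)
  have "(\<Sum>i<n. (cmod (v $ i))\<^sup>2) > 0"
    using l by (intro sum_pos2[of _ l]) auto
  then have "complex_of_real (\<Sum>i<n. (cmod (v $ i))\<^sup>2) \<noteq> 0" by (metis less_irrefl of_real_eq_0_iff)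
  ultimately have "cnj z = z" unfolding q complex_cnj_mult complex_cnj_complex_of_real by simp
  then obtain c where "z = complex_of_real c" by (metis Reals_cases Reals_cnj_iff)
  then show ?thesis using that[of c] ev nz_i by (simp add: A_def z_def)
qed

section \<open>Representations of the symmetric group\<close>

abbreviation sym_set :: "nat \<Rightarrow> (nat \<Rightarrow> nat) set" where
  "sym_set n \<equiv> carrier (sym_group n)"

lemma id_in_sym [simp]: "id \<in> sym_set n"
  by (simp add: sym_group_carrier permutes_id)

lemma comp_in_sym [simp]: "\<sigma> \<in> sym_set n \<Longrightarrow> \<tau> \<in> sym_set n \<Longrightarrow> \<sigma> \<circ> \<tau> \<in> sym_set n"
  by (simp add: sym_group_carrier permutes_compose)

lemma inv_in_sym [simp]: "\<sigma> \<in> sym_set n \<Longrightarrow> inv' \<sigma> \<in> sym_set n"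
  by (rule sym_group_inv_closed)

lemma inv_comp_sym [simp]:
  assumes "\<sigma> \<in> sym_set n"
  shows "inv' \<sigma> \<circ> \<sigma> = id" "\<sigma> \<circ> inv' \<sigma> = id"
  using assms by (auto simp: sym_group_carrier permutes_inv_o)

lemma comp_inv_comp_sym [simp]:
  assumes "\<sigma> \<in> sym_set n"
  shows "inv' \<sigma> \<circ> (\<sigma> \<circ> \<tau>) = \<tau>" "\<sigma> \<circ> (inv' \<sigma> \<circ> \<tau>) = \<tau>"
    "\<tau> \<circ> \<sigma> \<circ> inv' \<sigma> = \<tau>" "\<tau> \<circ> inv' \<sigma> \<circ> \<sigma> = \<tau>"
  using inv_comp_sym[OF assms] by (auto simp: fun_eq_iff)

lemma inv_inv_sym [simp]: "\<sigma> \<in> sym_set n \<Longrightarrow> inv' (inv' \<sigma>) = \<sigma>"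
  by (simp add: sym_group_carrier permutes_inv_inv)

lemma inv_comp_eq_sym:
  assumes "\<sigma> \<in> sym_set n" "\<tau> \<in> sym_set n"
  shows "inv' (\<sigma> \<circ> \<tau>) = inv' \<tau> \<circ> inv' \<sigma>"
  using assms by (auto simp: sym_group_carrier intro!: o_inv_distrib permutes_bij)

lemma finite_sym [simp]: "finite (sym_set n)"
  by (simp add: sym_group_def finite_permutations)

lemma sum_sym_left:
  "\<tau> \<in> sym_set n \<Longrightarrow> (\<Sum>\<sigma>\<in>sym_set n. F (\<tau> \<circ> \<sigma>)) = (\<Sum>\<sigma>\<in>sym_set n. F \<sigma>)"
  by (rule sum.reindex_bij_witness[of _ "\<lambda>\<sigma>. inv' \<tau> \<circ> \<sigma>" "\<lambda>\<sigma>. \<tau> \<circ> \<sigma>"]) auto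

lemma sum_sym_right:
  "\<tau> \<in> sym_set n \<Longrightarrow> (\<Sum>\<sigma>\<in>sym_set n. F (\<sigma> \<circ> \<tau>)) = (\<Sum>\<sigma>\<in>sym_set n. F \<sigma>)"
  by (rule sum.reindex_bij_witness[of _ "\<lambda>\<sigma>. \<sigma> \<circ> inv' \<tau>" "\<lambda>\<sigma>. \<sigma> \<circ> \<tau>"]) auto

lemma normal_elem_iff:
  "normal_elem n \<alpha> \<longleftrightarrow>
     (\<forall>\<sigma>\<in>sym_set n. \<forall>\<tau>\<in>sym_set n. \<alpha> (\<tau> \<circ> \<sigma> \<circ> inv' \<tau>) = \<alpha> \<sigma>)"
  by (simp add: normal_elem_def sym_group_mult)

text \<open>Conjugation by \<open>\<tau>\<close> turns \<open>\<sigma> \<circ> \<tau>\<close> into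
  \<open>\<tau> \<circ> \<sigma>\<close>.\<close>

lemma normal_elem_commute:
  assumes "normal_elem n \<alpha>" "\<sigma> \<in> sym_set n" "\<tau> \<in> sym_set n"
  shows "\<alpha> (\<sigma> \<circ> \<tau>) = \<alpha> (\<tau> \<circ> \<sigma>)"
proof -
  have "\<alpha> (\<tau> \<circ> (\<sigma> \<circ> \<tau>) \<circ> inv' \<tau>) = \<alpha> (\<sigma> \<circ> \<tau>)"
    using assms by (auto simp: normal_elem_iff)
  moreover have "\<tau> \<circ> (\<sigma> \<circ> \<tau>) \<circ> inv' \<tau> = \<tau> \<circ> \<sigma>"
    using assms(3) by (simp only: o_assoc comp_inv_comp_sym(3))
  ultimately show ?thesis by simp
qed

section \<open>Matrix representations and subrepresentations\<close>

text \<open>Invertibility is automatic: the image of the inverse permutation is the inverse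
  matrix.\<close>

lemma representationI:
  assumes carr: "\<And>\<sigma>. \<sigma> \<in> sym_set n \<Longrightarrow> \<rho> \<sigma> \<in> carrier_mat d d"
    and one: "\<rho> id = 1\<^sub>m d"
    and mult: "\<And>\<sigma> \<tau>. \<sigma> \<in> sym_set n \<Longrightarrow> \<tau> \<in> sym_set n \<Longrightarrow> \<rho> (\<sigma> \<circ> \<tau>) = \<rho> \<sigma> * \<rho> \<tau>"
  shows "representation n d \<rho>"
proof -
  have "\<rho> \<sigma> \<in> Units (ring_mat TYPE(complex) d ())" if s: "\<sigma> \<in> sym_set n" for \<sigma>
  proof -
    have "\<rho> (inv' \<sigma>) * \<rho> \<sigma> = 1\<^sub>m d" "\<rho> \<sigma> * \<rho> (inv' \<sigma>) = 1\<^sub>m d"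
      using mult[of "inv' \<sigma>" \<sigma>] mult[of \<sigma> "inv' \<sigma>"] s one by auto
    then show ?thesis using carr[OF s] carr[OF inv_in_sym[OF s]]
      by (auto simp: Units_def ring_mat_simps)
  qed
  then show ?thesis
    unfolding representation_def hom_def
    by (auto simp: units_of_def ring_mat_simps sym_group_mult mult)
qed

lemma representation_carrier:
  "representation n d \<rho> \<Longrightarrow> \<sigma> \<in> sym_set n \<Longrightarrow> \<rho> \<sigma> \<in> carrier_mat d d"
  by (auto simp: representation_def hom_def units_of_def Units_def ring_mat_simps)

lemma representation_comp:
  "representation n d \<rho> \<Longrightarrow> \<sigma> \<in> sym_set n \<Longrightarrow> \<tau> \<in> sym_set n \<Longrightarrow> \<rho> (\<sigma> \<circ> \<tau>) = \<rho> \<sigma> * \<rho> \<tau>"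
  by (auto simp: representation_def hom_def units_of_def ring_mat_simps sym_group_mult)

lemma representation_id:
  assumes "representation n d \<rho>"
  shows "\<rho> id = 1\<^sub>m d"
proof -
  interpret R: ring "ring_mat TYPE(complex) d ()" by (rule ring_mat)
  interpret group_hom "sym_group n" "units_of (ring_mat TYPE(complex) d ())" \<rho>
    using assms sym_group_is_group R.units_group
    by (auto simp: representation_def group_hom_def group_hom_axioms_def)
  show ?thesis using hom_one by (simp add: sym_group_one units_of_def ring_mat_simps)
qed

lemma rep_elem_carrier [simp]: "rep_elem n d \<rho> \<alpha> \<in> carrier_mat d d"
  by (simp add: rep_elem_def)

lemma dim_rep_elem [simp]:
  "dim_row (rep_elem n d \<rho> \<alpha>) = d" "dim_col (rep_elem n d \<rho> \<alpha>) = d"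
  by (simp_all add: rep_elem_def)

text \<open>Multiplication by \<open>B\<close> passes under the sum, which reduces identities for
  group algebra elements to single permutations. \<open>B\<close> may be rectangular: below it is a
  basis matrix, a single column, or some \<open>\<rho> \<tau>\<close>.\<close>

lemma rep_elem_mult_right:
  assumes "representation n d \<rho>" "B \<in> carrier_mat d m"
  shows "rep_elem n d \<rho> \<alpha> * B =
    mat d m (\<lambda>(i, j). \<Sum>\<sigma>\<in>sym_set n. complex_of_real (\<alpha> \<sigma>) * (\<rho> \<sigma> * B) $$ (i, j))" (is "_ = ?R")
proof (rule eq_matI)
  fix i j assume "i < dim_row ?R" "j < dim_col ?R"
  then have i: "i < d" and j: "j < m" by auto
  have "(rep_elem n d \<rho> \<alpha> * B) $$ (i, j) =
    (\<Sum>l = 0..<d. \<Sum>\<sigma>\<in>sym_set n. complex_of_real (\<alpha> \<sigma>) * \<rho> \<sigma> $$ (i, l) * B $$ (l, j))"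
    using i j assms(2) by (simp add: rep_elem_def scalar_prod_def sum_distrib_right)
  also have "\<dots> = (\<Sum>\<sigma>\<in>sym_set n. complex_of_real (\<alpha> \<sigma>) * (\<rho> \<sigma> * B) $$ (i, j))"
    unfolding sum.swap[of _ _ "{0..<d}"]
    using i j assms(2) representation_carrier[OF assms(1)]
    by (intro sum.cong refl) (force simp: scalar_prod_def sum_distrib_left mult.assoc)
  finally show "(rep_elem n d \<rho> \<alpha> * B) $$ (i, j) = ?R $$ (i, j)"
    using i j by simp
qed (use assms in auto)

lemma rep_elem_mult_left:
  assumes "representation n d \<rho>" "B \<in> carrier_mat m d"
  shows "B * rep_elem n d \<rho> \<alpha> =
    mat m d (\<lambda>(i, j). \<Sum>\<sigma>\<in>sym_set n. complex_of_real (\<alpha> \<sigma>) * (B * \<rho> \<sigma>) $$ (i, j))" (is "_ = ?R")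
proof (rule eq_matI)
  fix i j assume "i < dim_row ?R" "j < dim_col ?R"
  then have i: "i < m" and j: "j < d" by auto
  have "(B * rep_elem n d \<rho> \<alpha>) $$ (i, j) =
    (\<Sum>l = 0..<d. \<Sum>\<sigma>\<in>sym_set n. B $$ (i, l) * (complex_of_real (\<alpha> \<sigma>) * \<rho> \<sigma> $$ (l, j)))"
    using i j assms(2) by (simp add: rep_elem_def scalar_prod_def sum_distrib_left)
  also have "\<dots> = (\<Sum>\<sigma>\<in>sym_set n. complex_of_real (\<alpha> \<sigma>) * (B * \<rho> \<sigma>) $$ (i, j))"
    unfolding sum.swap[of _ _ "{0..<d}"]
    using i j assms(2) representation_carrier[OF assms(1)]
    by (intro sum.cong refl) (force simp: scalar_prod_def sum_distrib_left ac_simps)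
  finally show "(B * rep_elem n d \<rho> \<alpha>) $$ (i, j) = ?R $$ (i, j)"
    using i j by simp
qed (use assms in auto)

text \<open>Class functions are central in the group algebra: reindex by right translation, swap the
  two factors in the argument of \<open>\<alpha>\<close>, and reindex by left translation. Hence the
  eigenspaces of a class function are invariant.\<close>

lemma rep_elem_normal_commute:
  assumes rep: "representation n d \<rho>" and nrm: "normal_elem n \<alpha>" and t: "\<tau> \<in> sym_set n"
  shows "rep_elem n d \<rho> \<alpha> * \<rho> \<tau> = \<rho> \<tau> * rep_elem n d \<rho> \<alpha>"
proof -
  note c = representation_carrier[OF rep t]
  have "(\<Sum>\<sigma>\<in>sym_set n. complex_of_real (\<alpha> \<sigma>) * (\<rho> \<sigma> * \<rho> \<tau>) $$ (i, j)) =
    (\<Sum>\<sigma>\<in>sym_set n. complex_of_real (\<alpha> \<sigma>) * (\<rho> \<tau> * \<rho> \<sigma>) $$ (i, j))" for i j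
  proof -
    have "(\<Sum>\<sigma>\<in>sym_set n. complex_of_real (\<alpha> \<sigma>) * (\<rho> \<sigma> * \<rho> \<tau>) $$ (i, j)) =
      (\<Sum>\<sigma>\<in>sym_set n. complex_of_real (\<alpha> ((\<sigma> \<circ> \<tau>) \<circ> inv' \<tau>)) * \<rho> (\<sigma> \<circ> \<tau>) $$ (i, j))"
      using t by (intro sum.cong) (auto simp: representation_comp[OF rep])
    also have "\<dots> = (\<Sum>\<sigma>\<in>sym_set n. complex_of_real (\<alpha> (\<sigma> \<circ> inv' \<tau>)) * \<rho> \<sigma> $$ (i, j))"
      by (rule sum_sym_right[OF t])
    also have "\<dots> = (\<Sum>\<sigma>\<in>sym_set n. complex_of_real (\<alpha> (inv' \<tau> \<circ> \<sigma>)) * \<rho> \<sigma> $$ (i, j))"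
      using normal_elem_commute[OF nrm] t by (intro sum.cong) auto
    also have "\<dots> = (\<Sum>\<sigma>\<in>sym_set n. complex_of_real (\<alpha> (inv' \<tau> \<circ> (\<tau> \<circ> \<sigma>))) * \<rho> (\<tau> \<circ> \<sigma>) $$ (i, j))"
      by (rule sum_sym_left[OF t, symmetric])
    also have "\<dots> = (\<Sum>\<sigma>\<in>sym_set n. complex_of_real (\<alpha> \<sigma>) * (\<rho> \<tau> * \<rho> \<sigma>) $$ (i, j))"
      using t by (intro sum.cong refl) (simp only: comp_inv_comp_sym representation_comp[OF rep])
    finally show ?thesis .
  qed
  then show ?thesis
    unfolding rep_elem_mult_right[OF rep c] rep_elem_mult_left[OF rep c] by simp
qed

text \<open>The restriction to \<open>W\<close> is written in the basis given by the columns of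
  \<open>B\<close>: the matrices \<open>A \<sigma>\<close> satisfy
  \<open>B * A \<sigma> = \<rho> \<sigma> * B\<close>, and cancelling the injective \<open>B\<close>
  carries the identities for \<open>\<rho>\<close> over to \<open>A\<close>.\<close>

lemma subrepresentation:
  assumes rep: "representation n d \<rho>"
    and sub: "W \<subseteq> carrier_vec d" and zero: "0\<^sub>v d \<in> W"
    and add: "\<And>v w. v \<in> W \<Longrightarrow> w \<in> W \<Longrightarrow> v + w \<in> W"
    and smult: "\<And>c w. w \<in> W \<Longrightarrow> c \<cdot>\<^sub>v w \<in> W"
    and inv: "\<And>\<sigma> w. \<sigma> \<in> sym_set n \<Longrightarrow> w \<in> W \<Longrightarrow> \<rho> \<sigma> *\<^sub>v w \<in> W"
    and eig: "\<And>w. w \<in> W \<Longrightarrow> rep_elem n d \<rho> f *\<^sub>v w = c \<cdot>\<^sub>v w"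
  obtains m A where "representation n m A" "rep_elem n m A f = c \<cdot>\<^sub>m 1\<^sub>m m"
    "W \<noteq> {0\<^sub>v d} \<Longrightarrow> 0 < m" "W \<noteq> carrier_vec d \<Longrightarrow> m < d"
proof -
  obtain m B where inj: "inj_mat d m B" and ran: "(\<lambda>v. B *\<^sub>v v) ` carrier_vec m = W"
    and m: "W \<noteq> {0\<^sub>v d} \<Longrightarrow> 0 < m" "W \<noteq> carrier_vec d \<Longrightarrow> m < d"
    using basis_mat_exists[OF sub zero add smult] by metis
  have B: "B \<in> carrier_mat d m" using inj by (simp add: inj_mat_def)
  have colW: "col B j \<in> W" if "j < m" for j
  proof -
    have "col B j = B *\<^sub>v unit_vec m j"
      using that B by (intro eq_vecI) auto
    then show ?thesis using ran by auto
  qed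
  \<comment> \<open>Coordinates of the image of the \<open>j\<close>-th basis vector; they exist
    because \<open>W\<close> is invariant and is the range of \<open>B\<close>.\<close>
  define x where "x \<sigma> j = (SOME v. v \<in> carrier_vec m \<and> B *\<^sub>v v = \<rho> \<sigma> *\<^sub>v col B j)" for \<sigma> j
  have x: "x \<sigma> j \<in> carrier_vec m \<and> B *\<^sub>v x \<sigma> j = \<rho> \<sigma> *\<^sub>v col B j"
    if "\<sigma> \<in> sym_set n" "j < m" for \<sigma> j
  proof -
    have "\<exists>v. v \<in> carrier_vec m \<and> B *\<^sub>v v = \<rho> \<sigma> *\<^sub>v col B j"
      using inv[OF that(1) colW[OF that(2)]] ran by force
    then show ?thesis unfolding x_def by (rule someI_ex)
  qed
  define A where "A \<sigma> = mat m m (\<lambda>(i, j). x \<sigma> j $ i)" for \<sigma>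
  have A: "A \<sigma> \<in> carrier_mat m m" for \<sigma> by (simp add: A_def)
  have BA: "B * A \<sigma> = \<rho> \<sigma> * B" if s: "\<sigma> \<in> sym_set n" for \<sigma>
  proof (rule mat_col_eqI)
    note r = representation_carrier[OF rep s]
    fix j assume "j < dim_col (\<rho> \<sigma> * B)"
    then have j: "j < m" using B by simp
    have "col (A \<sigma>) j = x \<sigma> j"
      using x[OF s j] j by (intro eq_vecI) (auto simp: A_def)
    then show "col (B * A \<sigma>) j = col (\<rho> \<sigma> * B) j"
      using x[OF s j] col_mult2[OF B A j] col_mult2[OF r B j] by simp
  qed (use A B representation_carrier[OF rep s] in auto)
  have repA: "representation n m A"
  proof (rule representationI[OF A])
    have "B * A id = B * 1\<^sub>m m" using BA[of id] B representation_id[OF rep] by simp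
    from inj_mat_cancel[OF inj A _ this] show "A id = 1\<^sub>m m" by simp
    fix \<sigma> \<tau> assume s: "\<sigma> \<in> sym_set n" and t: "\<tau> \<in> sym_set n"
    note r = representation_carrier[OF rep]
    have "B * A (\<sigma> \<circ> \<tau>) = \<rho> \<sigma> * \<rho> \<tau> * B" using BA s t representation_comp[OF rep] by simp
    also have "\<dots> = \<rho> \<sigma> * (B * A \<tau>)" using BA[OF t] assoc_mult_mat[OF r[OF s] r[OF t] B] by simp
    also have "\<dots> = B * A \<sigma> * A \<tau>" using BA[OF s] assoc_mult_mat[OF r[OF s] B A] by simp
    also have "\<dots> = B * (A \<sigma> * A \<tau>)" by (rule assoc_mult_mat[OF B A A])
    finally show "A (\<sigma> \<circ> \<tau>) = A \<sigma> * A \<tau>"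
      using inj_mat_cancel[OF inj] A by (meson mult_carrier_mat)
  qed
  \<comment> \<open>\<open>B\<close> intertwines the two representations permutation by permutation,
    hence also their extensions to the group algebra.\<close>
  have "B * rep_elem n m A f = rep_elem n d \<rho> f * B"
    unfolding rep_elem_mult_left[OF repA B] rep_elem_mult_right[OF rep B]
    by (intro cong_mat) (auto simp: BA intro!: sum.cong)
  also have "\<dots> = c \<cdot>\<^sub>m B"
  proof (rule mat_col_eqI)
    fix j assume "j < dim_col (c \<cdot>\<^sub>m B)"
    then have j: "j < m" using B by simp
    show "col (rep_elem n d \<rho> f * B) j = col (c \<cdot>\<^sub>m B) j"
      using col_mult2[OF rep_elem_carrier B j] eig[OF colW[OF j]] B j by simp
  qed (use B in auto)
  also have "\<dots> = B * (c \<cdot>\<^sub>m 1\<^sub>m m)" using B by (simp add: mult_smult_distrib[of _ d m _ m])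
  finally have "rep_elem n m A f = c \<cdot>\<^sub>m 1\<^sub>m m"
    using inj_mat_cancel[OF inj] by (meson one_carrier_mat rep_elem_carrier smult_carrier_mat)
  with repA show ?thesis using m by (rule that)
qed

section \<open>The regular representation\<close>

text \<open>A numbering of the group, since the rows and columns of matrices are indexed by natural
  numbers.\<close>

definition reg_enum :: "nat \<Rightarrow> nat \<Rightarrow> (nat \<Rightarrow> nat)" where
  "reg_enum n = (SOME g. bij_betw g {0..<fact n} (sym_set n))"

lemma reg_enum: "bij_betw (reg_enum n) {0..<fact n} (sym_set n)"
proof -
  have "\<exists>g. bij_betw g {0..<fact n :: nat} (sym_set n)"
    using ex_bij_betw_nat_finite[OF finite_sym[of n]] by (simp add: sym_group_card_carrier)
  then show ?thesis unfolding reg_enum_def by (rule someI_ex)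
qed

lemma reg_enum_in [simp]: "i < fact n \<Longrightarrow> reg_enum n i \<in> sym_set n"
  using bij_betwE[OF reg_enum] by auto

definition regular_rep :: "nat \<Rightarrow> (nat \<Rightarrow> nat) \<Rightarrow> complex mat" where
  "regular_rep n \<sigma> = mat (fact n) (fact n)
     (\<lambda>(i, j). if reg_enum n i = \<sigma> \<circ> reg_enum n j then 1 else 0)"

lemma representation_regular: "representation n (fact n) (regular_rep n)"
proof (rule representationI)
  show "regular_rep n \<sigma> \<in> carrier_mat (fact n) (fact n)" for \<sigma> by (simp add: regular_rep_def)
  show "regular_rep n id = 1\<^sub>m (fact n)"
    using bij_betw_imp_inj_on[OF reg_enum, of n]
    by (intro eq_matI) (auto simp: regular_rep_def inj_on_def)
  fix \<sigma> \<tau> assume s: "\<sigma> \<in> sym_set n" and t: "\<tau> \<in> sym_set n"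
  show "regular_rep n (\<sigma> \<circ> \<tau>) = regular_rep n \<sigma> * regular_rep n \<tau>"
  proof (rule eq_matI)
    fix i j assume "i < dim_row (regular_rep n \<sigma> * regular_rep n \<tau>)"
      "j < dim_col (regular_rep n \<sigma> * regular_rep n \<tau>)"
    then have i: "i < fact n" and j: "j < fact n" by (auto simp: regular_rep_def)
    let ?g = "reg_enum n"
    have "(regular_rep n \<sigma> * regular_rep n \<tau>) $$ (i, j) =
      (\<Sum>l\<in>{0..<fact n}. if ?g l = \<tau> \<circ> ?g j then (if ?g i = \<sigma> \<circ> ?g l then 1 else 0) else 0)"
      using i j by (auto simp: regular_rep_def scalar_prod_def intro!: sum.cong)
    also have "\<dots> = (\<Sum>\<pi>\<in>sym_set n. if \<pi> = \<tau> \<circ> ?g j then (if ?g i = \<sigma> \<circ> \<pi> then 1 else 0) else 0)"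
      by (rule sum.reindex_bij_betw[OF reg_enum])
    also have "\<dots> = (if ?g i = \<sigma> \<circ> (\<tau> \<circ> ?g j) then 1 else 0)"
      using t j by simp
    finally show "regular_rep n (\<sigma> \<circ> \<tau>) $$ (i, j) = (regular_rep n \<sigma> * regular_rep n \<tau>) $$ (i, j)"
      using i j by (simp add: regular_rep_def o_assoc)
  qed (auto simp: regular_rep_def)
qed

text \<open>Exactly one permutation carries the \<open>j\<close>-th group element to the
  \<open>i\<close>-th by left multiplication. So the entries of this matrix are the coefficients of
  \<open>\<alpha>\<close> themselves, and it inherits symmetry and being nonzero from
  \<open>\<alpha>\<close>.\<close>

lemma rep_elem_regular:
  "rep_elem n (fact n) (regular_rep n) \<alpha> =
    mat (fact n) (fact n) (\<lambda>(i, j). complex_of_real (\<alpha> (reg_enum n i \<circ> inv' (reg_enum n j))))" (is "_ = ?R")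
proof (rule eq_matI)
  fix i j assume "i < dim_row ?R" "j < dim_col ?R"
  then have i: "i < fact n" and j: "j < fact n" by auto
  let ?g = "reg_enum n"
  have *: "?g i = \<sigma> \<circ> ?g j \<longleftrightarrow> \<sigma> = ?g i \<circ> inv' (?g j)" if "\<sigma> \<in> sym_set n" for \<sigma>
    using i j that by (metis comp_inv_comp_sym(3,4) reg_enum_in)
  have "rep_elem n (fact n) (regular_rep n) \<alpha> $$ (i, j) =
    (\<Sum>\<sigma>\<in>sym_set n. if \<sigma> = ?g i \<circ> inv' (?g j) then complex_of_real (\<alpha> \<sigma>) else 0)"
  proof -
    have "rep_elem n (fact n) (regular_rep n) \<alpha> $$ (i, j) =
      (\<Sum>\<sigma>\<in>sym_set n. complex_of_real (\<alpha> \<sigma>) * (if ?g i = \<sigma> \<circ> ?g j then 1 else 0))"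
      using i j by (simp add: rep_elem_def regular_rep_def)
    also have "\<dots> = (\<Sum>\<sigma>\<in>sym_set n. if \<sigma> = ?g i \<circ> inv' (?g j) then complex_of_real (\<alpha> \<sigma>) else 0)"
      by (intro sum.cong refl) (auto simp: * simp del: comp_apply)
    finally show ?thesis .
  qed
  also have "\<dots> = complex_of_real (\<alpha> (?g i \<circ> inv' (?g j)))" using i j by simp
  finally show "rep_elem n (fact n) (regular_rep n) \<alpha> $$ (i, j) = ?R $$ (i, j)"
    using i j by simp
qed (auto simp: rep_elem_def)

text \<open>
  The vector of matrix coefficients \<open>\<sigma> \<mapsto> (\<rho> (\<sigma>\<inverse>) v)\<^sub>l\<close> of an eigenvector
  \<open>v\<close> of \<open>\<rho>(\<Sigma>)\<close> is an eigenvector of \<open>\<Sigma>\<close> in the regular representation.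
\<close>

lemma eigenvalue_regular:
  assumes rep: "representation n d \<rho>" and ev: "eigenvalue (rep_elem n d \<rho> \<alpha>) z"
  shows "eigenvalue (rep_elem n (fact n) (regular_rep n) \<alpha>) z"
proof -
  note r = representation_carrier[OF rep]
  obtain v where v: "v \<in> carrier_vec d" "v \<noteq> 0\<^sub>v d" "rep_elem n d \<rho> \<alpha> *\<^sub>v v = z \<cdot>\<^sub>v v"
    using ev by (auto simp: eigenvalue_def eigenvector_def rep_elem_def)
  \<comment> \<open>This coordinate makes the coefficient function \<open>h\<close> nonzero, namely
    at \<open>id\<close>.\<close>
  then obtain l where l: "l < d" "v $ l \<noteq> 0" by (metis carrier_vecD eq_vecI index_zero_vec)
  define h where "h \<sigma> = (\<rho> (inv' \<sigma>) *\<^sub>v v) $ l" for \<sigma>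
  have hid: "h id = v $ l" using v representation_id[OF rep] by (simp add: h_def)
  \<comment> \<open>The vector \<open>v\<close> as a one-column matrix, to which
    \<open>rep_elem_mult_right\<close> applies.\<close>
  define V where "V = mat d 1 (\<lambda>(i, j). v $ i)"
  have V: "V \<in> carrier_mat d 1" by (simp add: V_def)
  have Vv: "(M * V) $$ (i, 0) = (M *\<^sub>v v) $ i" if "M \<in> carrier_mat d d" "i < d" for M i
    using that v(1) by (simp add: V_def scalar_prod_def)
  \<comment> \<open>Substitute \<open>\<pi> = \<sigma> \<circ> inv' \<tau>\<close>, pull
    \<open>\<rho> (inv' \<sigma>)\<close> out of the sum and apply the eigenvector equation to what
    remains.\<close>
  have conv: "(\<Sum>\<tau>\<in>sym_set n. complex_of_real (\<alpha> (\<sigma> \<circ> inv' \<tau>)) * h \<tau>) = z * h \<sigma>"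
    if s: "\<sigma> \<in> sym_set n" for \<sigma>
  proof -
    note si = inv_in_sym[OF s]
    have "(\<Sum>\<tau>\<in>sym_set n. complex_of_real (\<alpha> (\<sigma> \<circ> inv' \<tau>)) * h \<tau>) =
      (\<Sum>\<pi>\<in>sym_set n. complex_of_real (\<alpha> \<pi>) * h (inv' \<pi> \<circ> \<sigma>))"
      using s by (intro sum.reindex_bij_witness[of _ "\<lambda>\<pi>. inv' \<pi> \<circ> \<sigma>" "\<lambda>\<tau>. \<sigma> \<circ> inv' \<tau>"])
        (auto simp: inv_comp_eq_sym[where n = n] simp flip: o_assoc)
    also have "\<dots> = (\<Sum>\<pi>\<in>sym_set n. complex_of_real (\<alpha> \<pi>) * (\<rho> (inv' \<sigma>) * (\<rho> \<pi> * V)) $$ (l, 0))"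
    proof (intro sum.cong refl)
      fix \<pi> assume p: "\<pi> \<in> sym_set n"
      have "h (inv' \<pi> \<circ> \<sigma>) = (\<rho> (inv' \<sigma> \<circ> \<pi>) * V) $$ (l, 0)"
        using p s l r[of "inv' \<sigma> \<circ> \<pi>"] by (simp add: h_def inv_comp_eq_sym[where n = n] Vv)
      also have "\<rho> (inv' \<sigma> \<circ> \<pi>) * V = \<rho> (inv' \<sigma>) * (\<rho> \<pi> * V)"
        using representation_comp[OF rep si p] assoc_mult_mat[OF r[OF si] r[OF p] V] by simp
      finally show "complex_of_real (\<alpha> \<pi>) * h (inv' \<pi> \<circ> \<sigma>) =
        complex_of_real (\<alpha> \<pi>) * (\<rho> (inv' \<sigma>) * (\<rho> \<pi> * V)) $$ (l, 0)" by (rule arg_cong)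
    qed
    also have "\<dots> = (\<Sum>\<pi>\<in>sym_set n. \<Sum>i = 0..<d. \<rho> (inv' \<sigma>) $$ (l, i) *
      (complex_of_real (\<alpha> \<pi>) * (\<rho> \<pi> * V) $$ (i, 0)))"
      using r[OF si] r V l
      by (intro sum.cong refl, subst index_mult_mat(1))
        (auto simp: scalar_prod_def[of "row _ _"] sum_distrib_left simp del: index_mult_mat(1)
          intro!: sum.cong)
    also have "\<dots> = (\<Sum>i = 0..<d. \<rho> (inv' \<sigma>) $$ (l, i) * (rep_elem n d \<rho> \<alpha> * V) $$ (i, 0))"
      unfolding rep_elem_mult_right[OF rep V]
      by (subst sum.swap) (simp add: sum_distrib_left)
    also have "\<dots> = (\<Sum>i = 0..<d. \<rho> (inv' \<sigma>) $$ (l, i) * (z * v $ i))"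
      using v(1) by (intro sum.cong refl) (simp add: Vv[OF rep_elem_carrier] v(3) del: index_mult_mat_vec)
    also have "\<dots> = z * h \<sigma>"
      using r[OF si] l v(1) by (simp add: h_def scalar_prod_def sum_distrib_left ac_simps)
    finally show ?thesis .
  qed
  let ?g = "reg_enum n" and ?N = "fact n :: nat"
  define u where "u = vec ?N (\<lambda>i. h (?g i))"
  have "rep_elem n ?N (regular_rep n) \<alpha> *\<^sub>v u = z \<cdot>\<^sub>v u"
  proof (rule eq_vecI)
    fix i assume "i < dim_vec (z \<cdot>\<^sub>v u)"
    then have i: "i < ?N" by (simp add: u_def)
    have "(rep_elem n ?N (regular_rep n) \<alpha> *\<^sub>v u) $ i =
      (\<Sum>j\<in>{0..<?N}. complex_of_real (\<alpha> (?g i \<circ> inv' (?g j))) * h (?g j))"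
      using i by (simp add: rep_elem_regular u_def scalar_prod_def)
    also have "\<dots> = (\<Sum>\<tau>\<in>sym_set n. complex_of_real (\<alpha> (?g i \<circ> inv' \<tau>)) * h \<tau>)"
      by (rule sum.reindex_bij_betw[OF reg_enum])
    also have "\<dots> = z * h (?g i)" using i by (simp add: conv)
    finally show "(rep_elem n ?N (regular_rep n) \<alpha> *\<^sub>v u) $ i = (z \<cdot>\<^sub>v u) $ i"
      using i by (simp add: u_def)
  qed (auto simp: rep_elem_def u_def)
  moreover have "u \<noteq> 0\<^sub>v ?N"
  proof
    assume u: "u = 0\<^sub>v ?N"
    obtain i where "i < ?N" "?g i = id"
      using bij_betw_imp_surj_on[OF reg_enum, of n] id_in_sym[of n]
      by (metis (no_types, lifting) atLeastLessThan_iff imageE)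
    then have "u $ i = v $ l" using hid by (simp add: u_def)
    moreover have "u $ i = 0" using u \<open>i < ?N\<close> by simp
    ultimately show False using l by simp
  qed
  ultimately show ?thesis
    unfolding eigenvalue_def eigenvector_def by (intro exI[of _ u]) (auto simp: rep_elem_def u_def)
qed

section \<open>The values of \<open>lambda1\<close>\<close>

text \<open>Although the dimension \<open>d\<close> ranges over all positive numbers, all
  eigenvalues that occur are eigenvalues of one matrix, that of the regular representation.
  Finiteness makes the maximum in \<open>lambda_Sn\<close> an upper bound of the set.\<close>

lemma finite_lambda1_values:
  "finite {lambda1 (rep_elem n d \<rho> \<alpha>) | d \<rho>. irreducible_rep n d \<rho> \<and>
     \<not> equivalent_rep n \<rho> triv_rep \<and> \<not> equivalent_rep n \<rho> sgn_rep}" (is "finite ?L")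
proof -
  let ?R = "rep_elem n (fact n) (regular_rep n) \<alpha>"
  define E where "E = {c::real. eigenvalue ?R (complex_of_real c)}"
  have R: "?R \<in> carrier_mat (fact n) (fact n)" by simp
  have "char_poly ?R \<noteq> 0" using degree_monic_char_poly[OF R] by auto
  then have "finite {z. eigenvalue ?R z}"
    unfolding eigenvalue_root_char_poly[OF R] by (rule poly_roots_finite)
  then have fin: "finite E"
    unfolding E_def using finite_vimageI[of "{z. eigenvalue ?R z}" complex_of_real]
    by (simp add: inj_of_real vimage_def)
  \<comment> \<open>As \<open>\<alpha>\<close> is arbitrary here, there may be no real eigenvalue at
    all; \<open>lambda1\<close> is then the unspecified value \<open>Max {}\<close>.\<close>
  have "lambda1 (rep_elem n d \<rho> \<alpha>) \<in> insert (Max {}) E" if "irreducible_rep n d \<rho>" for d \<rho>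
  proof -
    have rep: "representation n d \<rho>" using that by (simp add: irreducible_rep_def)
    define X where "X = {c::real. eigenvalue (rep_elem n d \<rho> \<alpha>) (complex_of_real c)}"
    have "X \<subseteq> E" unfolding X_def E_def using eigenvalue_regular[OF rep] by auto
    then have "X \<noteq> {} \<Longrightarrow> Max X \<in> E" using Max_in[of X] finite_subset[OF _ fin] by blast
    then show ?thesis unfolding lambda1_def X_def[symmetric] by (cases "X = {}") auto
  qed
  then have "?L \<subseteq> insert (Max {}) E" by blast
  then show ?thesis using fin finite_subset by blast
qed

lemma smult_one_mult_vec:
  "v \<in> carrier_vec d \<Longrightarrow> (c \<cdot>\<^sub>m 1\<^sub>m d) *\<^sub>v v = c \<cdot>\<^sub>v (v :: 'a::comm_ring_1 vec)"
  by (intro eq_vecI) (auto simp: smult_scalar_prod_distrib[of _ d])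

lemma lambda1_scalar:
  assumes "0 < d"
  shows "lambda1 (complex_of_real c \<cdot>\<^sub>m 1\<^sub>m d) = c"
proof -
  note id = smult_one_mult_vec[where c = "complex_of_real c" and d = d]
  have "eigenvalue (complex_of_real c \<cdot>\<^sub>m 1\<^sub>m d) (complex_of_real x) \<longleftrightarrow> x = c" for x
  proof
    assume "eigenvalue (complex_of_real c \<cdot>\<^sub>m 1\<^sub>m d) (complex_of_real x)"
    then obtain v where v: "v \<in> carrier_vec d" "v \<noteq> 0\<^sub>v d"
      "complex_of_real c \<cdot>\<^sub>v v = complex_of_real x \<cdot>\<^sub>v v"
      using id by (auto simp: eigenvalue_def eigenvector_def)
    then obtain i where i: "i < d" "v $ i \<noteq> 0" by (metis carrier_vecD eq_vecI index_zero_vec)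
    from arg_cong[OF v(3), of "\<lambda>w. w $ i"] i v(1) show "x = c" by simp
  next
    assume "x = c"
    moreover have "unit_vec d 0 \<noteq> (0\<^sub>v d :: complex vec)" using assms by simp
    ultimately show "eigenvalue (complex_of_real c \<cdot>\<^sub>m 1\<^sub>m d) (complex_of_real x)"
      unfolding eigenvalue_def eigenvector_def using id
      by (intro exI[of _ "unit_vec d 0"]) auto
  qed
  then show ?thesis by (simp add: lambda1_def)
qed

section \<open>An irreducible representation with a nonzero scalar\<close>

text \<open>An eigenspace of \<open>f\<close> in the regular representation is a representation on
  which \<open>f\<close> is a scalar \<open>c\<close>. One of least positive dimension with this
  scalar is irreducible, since a proper nonzero invariant subspace would carry a smaller
  one.\<close>

lemma exists_irreducible_scalar:
  assumes nrm: "normal_elem n f"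
    and sym: "\<And>\<sigma>. \<sigma> \<in> sym_set n \<Longrightarrow> f (inv' \<sigma>) = f \<sigma>"
    and nz: "\<sigma>0 \<in> sym_set n" "f \<sigma>0 \<noteq> 0"
  obtains c d \<rho> where "c \<noteq> 0" "irreducible_rep n d \<rho>"
    "rep_elem n d \<rho> f = complex_of_real c \<cdot>\<^sub>m 1\<^sub>m d"
proof -
  let ?N = "fact n :: nat" and ?R = "regular_rep n" and ?g = "reg_enum n"
  have ex: "\<exists>i<?N. ?g i = \<sigma>" if "\<sigma> \<in> sym_set n" for \<sigma>
    using that bij_betw_imp_surj_on[OF reg_enum, of n]
    by (metis (no_types, lifting) atLeastLessThan_iff imageE)
  \<comment> \<open>The matrix entry at these indices is \<open>f \<sigma>0\<close>.\<close>
  obtain i0 j0 where ij: "i0 < ?N" "?g i0 = \<sigma>0" "j0 < ?N" "?g j0 = id"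
    using ex[OF nz(1)] ex[OF id_in_sym] by auto
  obtain c where c: "c \<noteq> 0" and ev: "eigenvalue (rep_elem n ?N ?R f) (complex_of_real c)"
    unfolding rep_elem_regular
  proof (rule symmetric_nonzero_real_eigenvalue[of ?N "\<lambda>i j. f (?g i \<circ> inv' (?g j))" i0 j0])
    fix i j assume "i < ?N" "j < ?N"
    then show "f (?g i \<circ> inv' (?g j)) = f (?g j \<circ> inv' (?g i))"
      using sym[of "?g j \<circ> inv' (?g i)"] by (simp add: inv_comp_eq_sym[where n = n] inv_inv_sym[where n = n])
  qed (use ij nz in auto)
  define P where "P d \<longleftrightarrow> 0 < d \<and>
    (\<exists>\<rho>. representation n d \<rho> \<and> rep_elem n d \<rho> f = complex_of_real c \<cdot>\<^sub>m 1\<^sub>m d)" for d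
  have "\<exists>d. P d"
  proof -
    define F where "F = rep_elem n ?N ?R f"
    have F: "F \<in> carrier_mat ?N ?N" by (simp add: F_def)
    define W where "W = {v \<in> carrier_vec ?N. F *\<^sub>v v = complex_of_real c \<cdot>\<^sub>v v}"
    obtain v where v: "v \<in> W" "v \<noteq> 0\<^sub>v ?N"
      using ev by (auto simp: eigenvalue_def eigenvector_def W_def F_def)
    have ne: "W \<noteq> {0\<^sub>v ?N}" using v by auto
    obtain m A where A: "representation n m A" "rep_elem n m A f = complex_of_real c \<cdot>\<^sub>m 1\<^sub>m m"
      "0 < m"
    proof (rule subrepresentation[OF representation_regular, of W n f "complex_of_real c"])
      show "W \<subseteq> carrier_vec ?N" by (auto simp: W_def)
      show "0\<^sub>v ?N \<in> W" using F by (auto simp: W_def)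
      show "v + w \<in> W" if "v \<in> W" "w \<in> W" for v w
        using that F by (auto simp: W_def mult_add_distrib_mat_vec smult_add_distrib_vec)
      show "a \<cdot>\<^sub>v w \<in> W" if "w \<in> W" for a w
        using that F by (auto simp: W_def mult_mat_vec smult_smult_assoc mult.commute)
      show "rep_elem n ?N ?R f *\<^sub>v w = complex_of_real c \<cdot>\<^sub>v w" if "w \<in> W" for w
        using that by (simp add: W_def F_def)
      \<comment> \<open>The eigenspace is invariant because \<open>f\<close> is central.\<close>
      show "?R \<sigma> *\<^sub>v w \<in> W" if s: "\<sigma> \<in> sym_set n" and w: "w \<in> W" for \<sigma> w
      proof -
        note r = representation_carrier[OF representation_regular s]
        have w': "w \<in> carrier_vec ?N" "F *\<^sub>v w = complex_of_real c \<cdot>\<^sub>v w"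
          using w by (auto simp: W_def)
        have "F *\<^sub>v (?R \<sigma> *\<^sub>v w) = F * ?R \<sigma> *\<^sub>v w"
          using assoc_mult_mat_vec[OF F r w'(1)] by simp
        also have "\<dots> = ?R \<sigma> * F *\<^sub>v w"
          unfolding F_def rep_elem_normal_commute[OF representation_regular nrm s] ..
        also have "\<dots> = ?R \<sigma> *\<^sub>v (complex_of_real c \<cdot>\<^sub>v w)"
          using assoc_mult_mat_vec[OF r F w'(1)] w'(2) by simp
        also have "\<dots> = complex_of_real c \<cdot>\<^sub>v (?R \<sigma> *\<^sub>v w)"
          by (rule mult_mat_vec[OF r w'(1)])
        finally show ?thesis using r w'(1) by (simp add: W_def)
      qed
    qed (use ne in auto)
    then show ?thesis unfolding P_def by blast
  qed
  then have "P (LEAST d. P d)" by (rule LeastI_ex)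
  moreover define d where "d = (LEAST d. P d)"
  ultimately have Pd: "P d" by simp
  have least: "d \<le> m" if "P m" for m unfolding d_def using that by (rule Least_le)
  obtain \<rho> where rep: "representation n d \<rho>"
    and scal: "rep_elem n d \<rho> f = complex_of_real c \<cdot>\<^sub>m 1\<^sub>m d" and d0: "0 < d"
    using Pd unfolding P_def by auto
  have "irreducible_rep n d \<rho>"
    unfolding irreducible_rep_def
  proof (intro conjI rep d0 allI impI)
    fix W :: "complex vec set"
    assume sub: "VectorSpace.subspace class_ring W (module_vec TYPE(complex) d)"
      and inv: "\<forall>\<sigma>\<in>sym_set n. \<forall>w\<in>W. \<rho> \<sigma> *\<^sub>v w \<in> W"
    interpret vec_space "TYPE(complex)" d .
    have W: "submodule class_ring W V" using sub by (simp add: subspace_def)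
    have Wc: "W \<subseteq> carrier_vec d" using W by (simp add: submodule_def)
    show "W = {0\<^sub>v d} \<or> W = carrier_vec d"
    proof (rule ccontr)
      assume ne: "\<not> (W = {0\<^sub>v d} \<or> W = carrier_vec d)"
      obtain m A where A: "representation n m A" "rep_elem n m A f = complex_of_real c \<cdot>\<^sub>m 1\<^sub>m m"
        "0 < m" "m < d"
      proof (rule subrepresentation[OF rep Wc, of f "complex_of_real c"])
        show "0\<^sub>v d \<in> W" using W by (simp add: submodule_def)
        show "v + w \<in> W" if "v \<in> W" "w \<in> W" for v w using W that by (simp add: submodule_def)
        show "a \<cdot>\<^sub>v w \<in> W" if "w \<in> W" for a w using W that by (simp add: submodule_def)
        show "\<rho> \<sigma> *\<^sub>v w \<in> W" if "\<sigma> \<in> sym_set n" "w \<in> W" for \<sigma> w using inv that by auto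
        show "rep_elem n d \<rho> f *\<^sub>v w = complex_of_real c \<cdot>\<^sub>v w" if "w \<in> W" for w
          using that Wc unfolding scal by (intro smult_one_mult_vec) auto
      qed (use ne in auto)
      then have "P m" by (auto simp: P_def)
      with least \<open>m < d\<close> show False by force
    qed
  qed
  from c this scal show ?thesis by (rule that)
qed

section \<open>Even permutations and positivity of the eigenvalue\<close>

lemma evenperm_comp_sym:
  "\<sigma> \<in> sym_set n \<Longrightarrow> \<tau> \<in> sym_set n \<Longrightarrow> evenperm (\<sigma> \<circ> \<tau>) \<longleftrightarrow> evenperm \<sigma> = evenperm \<tau>"
  by (intro evenperm_comp sym_group_carrier')

lemma evenperm_inv_sym: "\<sigma> \<in> sym_set n \<Longrightarrow> evenperm (inv' \<sigma>) \<longleftrightarrow> evenperm \<sigma>"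
  by (intro evenperm_inv sym_group_carrier')

text \<open>Right translation by an even permutation preserves parity, hence the
  coefficients.\<close>

lemma rep_elem_even_mult:
  assumes rep: "representation n d \<rho>" and t: "\<tau> \<in> sym_set n" "evenperm \<tau>"
  shows "rep_elem n d \<rho> (\<lambda>\<sigma>. if evenperm \<sigma> then M else 0) * \<rho> \<tau> =
    rep_elem n d \<rho> (\<lambda>\<sigma>. if evenperm \<sigma> then M else 0)"
proof -
  define e where "e \<sigma> = (if evenperm \<sigma> then M else 0)" for \<sigma> :: "nat \<Rightarrow> nat"
  have "(\<Sum>\<sigma>\<in>sym_set n. complex_of_real (e \<sigma>) * (\<rho> \<sigma> * \<rho> \<tau>) $$ (i, j)) =
    (\<Sum>\<sigma>\<in>sym_set n. complex_of_real (e \<sigma>) * \<rho> \<sigma> $$ (i, j))" for i j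
  proof -
    have "(\<Sum>\<sigma>\<in>sym_set n. complex_of_real (e \<sigma>) * (\<rho> \<sigma> * \<rho> \<tau>) $$ (i, j)) =
      (\<Sum>\<sigma>\<in>sym_set n. complex_of_real (e (\<sigma> \<circ> \<tau>)) * \<rho> (\<sigma> \<circ> \<tau>) $$ (i, j))"
      using t by (intro sum.cong) (auto simp: e_def representation_comp[OF rep] evenperm_comp_sym)
    also have "\<dots> = (\<Sum>\<sigma>\<in>sym_set n. complex_of_real (e \<sigma>) * \<rho> \<sigma> $$ (i, j))"
      by (rule sum_sym_right[OF t(1)])
    finally show ?thesis .
  qed
  then show ?thesis
    unfolding rep_elem_mult_right[OF rep representation_carrier[OF rep t(1)]] e_def[symmetric]
    by (simp add: rep_elem_def)
qed

text \<open>Let \<open>E\<close> be the matrix in question. It absorbs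
  \<open>\<rho> \<sigma>\<close> for even \<open>\<sigma>\<close>, and \<open>f\<close> lives on
  even permutations, so \<open>E * rep_elem n d \<rho> f\<close> is \<open>E\<close> times the
  coefficient sum of \<open>f\<close>, which is zero. The same product is \<open>c\<close> times
  \<open>E\<close>.\<close>

lemma rep_elem_even_eq_zero:
  assumes rep: "representation n d \<rho>"
    and odd: "\<And>\<sigma>. \<sigma> \<in> sym_set n \<Longrightarrow> \<not> evenperm \<sigma> \<Longrightarrow> f \<sigma> = 0"
    and sum0: "(\<Sum>\<sigma>\<in>sym_set n. f \<sigma>) = 0"
    and scal: "rep_elem n d \<rho> f = complex_of_real c \<cdot>\<^sub>m 1\<^sub>m d" and c: "c \<noteq> 0"
  shows "rep_elem n d \<rho> (\<lambda>\<sigma>. if evenperm \<sigma> then M else 0) = 0\<^sub>m d d"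
proof -
  define E where "E = rep_elem n d \<rho> (\<lambda>\<sigma>. if evenperm \<sigma> then M else 0)"
  have E: "E \<in> carrier_mat d d" by (simp add: E_def)
  have "E * rep_elem n d \<rho> f = 0\<^sub>m d d"
  proof -
    have "(\<Sum>\<sigma>\<in>sym_set n. complex_of_real (f \<sigma>) * (E * \<rho> \<sigma>) $$ (i, j)) = 0" for i j
    proof -
      have "(\<Sum>\<sigma>\<in>sym_set n. complex_of_real (f \<sigma>) * (E * \<rho> \<sigma>) $$ (i, j)) =
        (\<Sum>\<sigma>\<in>sym_set n. complex_of_real (f \<sigma>) * E $$ (i, j))"
      proof (intro sum.cong refl)
        fix \<sigma> assume s: "\<sigma> \<in> sym_set n"
        show "complex_of_real (f \<sigma>) * (E * \<rho> \<sigma>) $$ (i, j) = complex_of_real (f \<sigma>) * E $$ (i, j)"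
        proof (cases "evenperm \<sigma>")
          case True
          then have "E * \<rho> \<sigma> = E" unfolding E_def by (rule rep_elem_even_mult[OF rep s])
          then show ?thesis by simp
        qed (simp add: odd[OF s])
      qed
      also have "\<dots> = complex_of_real (\<Sum>\<sigma>\<in>sym_set n. f \<sigma>) * E $$ (i, j)"
        by (simp add: sum_distrib_right)
      finally show ?thesis using sum0 by simp
    qed
    then show ?thesis
      unfolding rep_elem_mult_left[OF rep E] by (intro eq_matI) auto
  qed
  moreover have "E * rep_elem n d \<rho> f = complex_of_real c \<cdot>\<^sub>m E"
    unfolding scal using E by (simp add: mult_smult_distrib[of _ d d _ d])
  ultimately have "complex_of_real c \<cdot>\<^sub>m E = 0\<^sub>m d d" by simp
  then have "complex_of_real c * E $$ (i, j) = 0" if "i < d" "j < d" for i j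
    using that E by (metis carrier_matD(1,2) index_smult_mat(1) index_zero_mat(1))
  then show ?thesis using c E unfolding E_def[symmetric] by (intro eq_matI) auto
qed

text \<open>On a representation equivalent to the trivial or the sign one, \<open>f\<close> would
  act as its coefficient sum 0, so the irreducible representation with scalar
  \<open>c \<noteq> 0\<close> is admissible in \<open>lambda_Sn\<close>. The even part acts there as
  0; with \<open>s = sgn c\<close> the whole element acts as \<open>\<bar>c\<bar>\<close>, whatever
  \<open>M\<close> is.\<close>

lemma lambda_Sn_pos:
  assumes nrm: "normal_elem n f"
    and sym: "\<And>\<sigma>. \<sigma> \<in> sym_set n \<Longrightarrow> f (inv' \<sigma>) = f \<sigma>"
    and nz: "\<sigma>0 \<in> sym_set n" "f \<sigma>0 \<noteq> 0"
    and odd: "\<And>\<sigma>. \<sigma> \<in> sym_set n \<Longrightarrow> \<not> evenperm \<sigma> \<Longrightarrow> f \<sigma> = 0"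
    and sum0: "(\<Sum>\<sigma>\<in>sym_set n. f \<sigma>) = 0"
  obtains s :: real where "\<bar>s\<bar> = 1"
    "\<And>M. 0 < lambda_Sn n (\<lambda>\<sigma>. (if evenperm \<sigma> then M else 0) + s * f \<sigma>)"
proof -
  obtain c d \<rho> where c: "c \<noteq> 0" and irr: "irreducible_rep n d \<rho>"
    and scal: "rep_elem n d \<rho> f = complex_of_real c \<cdot>\<^sub>m 1\<^sub>m d"
    using exists_irreducible_scalar[OF nrm sym nz] .
  have rep: "representation n d \<rho>" and d: "0 < d" using irr by (auto simp: irreducible_rep_def)
  have entry: "(\<Sum>\<sigma>\<in>sym_set n. complex_of_real (f \<sigma>) * \<rho> \<sigma> $$ (0, 0)) = complex_of_real c"
    using arg_cong[OF scal, of "\<lambda>A. A $$ (0, 0)"] d by (simp add: rep_elem_def)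
  have sum0': "(\<Sum>\<sigma>\<in>sym_set n. complex_of_real (f \<sigma>)) = 0"
    using sum0 by (simp flip: of_real_sum)
  have dim1: "d = 1" if "similar_mat_wit (\<rho> \<sigma>) A P Q" "A \<in> carrier_mat 1 1" "\<sigma> \<in> sym_set n" for A P Q \<sigma>
    using that(2) similar_mat_witD2(5)[OF representation_carrier[OF rep that(3)] that(1)] by auto
  have ntriv: "\<not> equivalent_rep n \<rho> triv_rep"
  proof
    assume "equivalent_rep n \<rho> triv_rep"
    then obtain P Q where w: "similar_mat_wit (\<rho> \<sigma>) (1\<^sub>m 1) P Q" if "\<sigma> \<in> sym_set n" for \<sigma>
      by (auto simp: equivalent_rep_def triv_rep_def)
    have d1: "d = 1" using dim1[OF w[OF id_in_sym]] by simp
    have "\<rho> \<sigma> = 1\<^sub>m 1" if s: "\<sigma> \<in> sym_set n" for \<sigma>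
      using similar_mat_witD2[OF representation_carrier[OF rep s] w[OF s]] d1 by simp
    then show False using entry sum0' c by simp
  qed
  have nsgn: "\<not> equivalent_rep n \<rho> sgn_rep"
  proof
    assume "equivalent_rep n \<rho> sgn_rep"
    then obtain P Q where w: "similar_mat_wit (\<rho> \<sigma>) (of_int (sign \<sigma>) \<cdot>\<^sub>m 1\<^sub>m 1) P Q"
      if "\<sigma> \<in> sym_set n" for \<sigma>
      by (auto simp: equivalent_rep_def sgn_rep_def)
    have d1: "d = 1" using dim1[OF w[OF id_in_sym]] by simp
    \<comment> \<open>Here \<open>\<rho>\<close> is the sign, which is 1 wherever \<open>f\<close>
      is nonzero.\<close>
    have "complex_of_real (f \<sigma>) * \<rho> \<sigma> $$ (0, 0) = complex_of_real (f \<sigma>)"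
      if s: "\<sigma> \<in> sym_set n" for \<sigma>
    proof (cases "evenperm \<sigma>")
      case True
      then have "of_int (sign \<sigma>) \<cdot>\<^sub>m 1\<^sub>m 1 = (1\<^sub>m 1 :: complex mat)"
        by (intro eq_matI) (auto simp: sign_def)
      with w[OF s] have "similar_mat_wit (\<rho> \<sigma>) (1\<^sub>m 1) P Q" by simp
      from similar_mat_witD2[OF representation_carrier[OF rep s] this] d1 show ?thesis by simp
    qed (simp add: odd[OF s])
    then have "(\<Sum>\<sigma>\<in>sym_set n. complex_of_real (f \<sigma>) * \<rho> \<sigma> $$ (0, 0)) =
      (\<Sum>\<sigma>\<in>sym_set n. complex_of_real (f \<sigma>))"
      by (intro sum.cong) auto
    then show False using entry sum0' c by simp
  qed
  have "0 < lambda_Sn n (\<lambda>\<sigma>. (if evenperm \<sigma> then M else 0) + sgn c * f \<sigma>)" for M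
  proof -
    define \<alpha> where "\<alpha> \<sigma> = (if evenperm \<sigma> then M else 0) + sgn c * f \<sigma>" for \<sigma>
    have zero: "rep_elem n d \<rho> (\<lambda>\<sigma>. if evenperm \<sigma> then M else 0) = 0\<^sub>m d d"
      using odd by (rule rep_elem_even_eq_zero[OF rep _ sum0 scal c])
    have "rep_elem n d \<rho> \<alpha> = rep_elem n d \<rho> (\<lambda>\<sigma>. if evenperm \<sigma> then M else 0) +
      complex_of_real (sgn c) \<cdot>\<^sub>m rep_elem n d \<rho> f"
      unfolding rep_elem_def \<alpha>_def
      by (intro eq_matI) (auto simp: ring_distribs sum.distrib sum_distrib_left mult.assoc)
    also have "\<dots> = complex_of_real \<bar>c\<bar> \<cdot>\<^sub>m 1\<^sub>m d"
      unfolding zero scal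
      by (intro eq_matI) (auto simp: abs_sgn mult.commute simp flip: of_real_mult)
    finally have "lambda1 (rep_elem n d \<rho> \<alpha>) = \<bar>c\<bar>" by (simp add: lambda1_scalar[OF d])
    moreover have "lambda1 (rep_elem n d \<rho> \<alpha>) \<le> lambda_Sn n \<alpha>"
      unfolding lambda_Sn_def using irr ntriv nsgn
      by (intro Max_ge finite_lambda1_values) auto
    ultimately show ?thesis using c unfolding \<alpha>_def by simp
  qed
  with c show ?thesis by (intro that[of "sgn c"]) (simp_all add: abs_sgn_eq)
qed

section \<open>Actions on tuples\<close>

lemma finite_tuples [simp]: "finite (tuples n k)"
proof (rule finite_subset)
  show "tuples n k \<subseteq> {xs. set xs \<subseteq> {1..n} \<and> length xs = k}" by (auto simp: tuples_def)
qed (simp add: finite_lists_length_eq)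

lemma map_in_tuples:
  assumes "\<sigma> \<in> sym_set n" "y \<in> tuples n k"
  shows "map \<sigma> y \<in> tuples n k"
proof -
  have p: "\<sigma> permutes {1..n}" using assms(1) by (simp add: sym_group_carrier)
  have "\<sigma> ` set y \<subseteq> {1..n}"
    using assms(2) permutes_image[OF p] by (auto simp: tuples_def simp del: atLeastAtMost_iff)
  then show ?thesis
    using assms(2) permutes_inj_on[OF p] by (simp add: tuples_def distinct_map)
qed

lemma map_sym_inject:
  assumes "\<tau> \<in> sym_set n"
  shows "map \<tau> x = map \<tau> y \<longleftrightarrow> x = y"
  using assms by (simp add: sym_group_carrier inj_map_eq_map permutes_inj)

text \<open>A constant matrix annihilates every function of sum zero, so 0 is the only candidate.
  The two points \<open>a\<close> and \<open>b\<close> show that it is attained.\<close>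

lemma max_eigenvalue_orth_const_const:
  assumes fin: "finite X" and ab: "a \<in> X" "b \<in> X" "a \<noteq> b"
    and const: "\<And>x y. x \<in> X \<Longrightarrow> y \<in> X \<Longrightarrow> M x y = \<kappa>"
  shows "max_eigenvalue_orth_const X M = 0"
proof -
  have eq: "(\<Sum>y\<in>X. M x y * f y) = 0" if "x \<in> X" "(\<Sum>x\<in>X. f x) = 0" for x f
  proof -
    have "(\<Sum>y\<in>X. M x y * f y) = (\<Sum>y\<in>X. \<kappa> * f y)"
      using that const by (intro sum.cong) auto
    then show ?thesis using that by (simp flip: sum_distrib_left)
  qed
  have "{c. \<exists>f. eigenfun X M f c \<and> (\<Sum>x\<in>X. f x) = 0} = {0}"
  proof (intro equalityI subsetI)
    fix c assume "c \<in> {c. \<exists>f. eigenfun X M f c \<and> (\<Sum>x\<in>X. f x) = 0}"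
    then obtain f where f: "eigenfun X M f c" "(\<Sum>x\<in>X. f x) = 0" by auto
    then obtain x where "x \<in> X" "f x \<noteq> 0" by (auto simp: eigenfun_def)
    with f eq show "c \<in> {0}" by (force simp: eigenfun_def)
  next
    fix c :: real assume "c \<in> {0}"
    \<comment> \<open>The difference of two point masses is nonzero and has sum zero.\<close>
    let ?f = "\<lambda>x. (if x = a then 1 else 0) - (if x = b then 1 else 0 :: real)"
    have "(\<Sum>x\<in>X. ?f x) = 0" using fin ab by (simp add: sum_subtractf)
    moreover have "eigenfun X M ?f 0"
      unfolding eigenfun_def using eq[OF _ \<open>(\<Sum>x\<in>X. ?f x) = 0\<close>] ab by auto
    ultimately show "c \<in> {c. \<exists>f. eigenfun X M f c \<and> (\<Sum>x\<in>X. f x) = 0}"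
      using \<open>c \<in> {0}\<close> by blast
  qed
  then show ?thesis by (simp add: max_eigenvalue_orth_const_def)
qed

section \<open>Orbits on tuples and on pairs of tuples\<close>

text \<open>Equal coincidence patterns make \<open>l ! i \<mapsto> l' ! i\<close> a well-defined
  bijection between the two sets of entries. Their complements in \<open>{1..n}\<close> have equal
  size, so it extends to a permutation.\<close>

lemma exists_sym_map_eq:
  assumes len: "length l = length l'" and sub: "set l \<subseteq> {1..n}" "set l' \<subseteq> {1..n}"
    and pat: "\<And>i j. i < length l \<Longrightarrow> j < length l \<Longrightarrow> l ! i = l ! j \<longleftrightarrow> l' ! i = l' ! j"
  obtains \<tau> where "\<tau> \<in> sym_set n" "map \<tau> l = l'"
proof -
  \<comment> \<open>Entries of \<open>l\<close> may repeat, so a position is chosen for each of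
    them.\<close>
  define p where "p a = (SOME i. i < length l \<and> l ! i = a)" for a
  have p: "p a < length l \<and> l ! p a = a" if "a \<in> set l" for a
    unfolding p_def by (rule someI_ex) (use that in \<open>auto simp: in_set_conv_nth\<close>)
  define h where "h a = l' ! p a" for a
  have h: "h (l ! i) = l' ! i" if "i < length l" for i
    using p[of "l ! i"] pat[of "p (l ! i)" i] that by (simp add: h_def)
  have bij1: "bij_betw h (set l) (set l')"
    unfolding bij_betw_def
  proof
    show "inj_on h (set l)"
      using h pat by (auto simp: inj_on_def in_set_conv_nth)
    have "map h l = l'" using h len by (intro nth_equalityI) auto
    then show "h ` set l = set l'" by (metis set_map)
  qed
  have "card ({1..n} - set l) = card ({1..n} - set l')"
    using bij_betw_same_card[OF bij1] sub by (simp add: card_Diff_subset)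
  then obtain g where bij2: "bij_betw g ({1..n} - set l) ({1..n} - set l')"
    using finite_same_card_bij[of "{1..n} - set l" "{1..n} - set l'"] by auto
  define \<tau> where "\<tau> a = (if a \<in> {1..n} then if a \<in> set l then h a else g a else a)" for a
  have "bij_betw \<tau> (set l \<union> ({1..n} - set l)) (set l' \<union> ({1..n} - set l'))"
  proof (rule bij_betw_combine)
    have "bij_betw \<tau> (set l) (set l') = bij_betw h (set l) (set l')"
      by (rule bij_betw_cong) (use sub in \<open>auto simp: \<tau>_def\<close>)
    with bij1 show "bij_betw \<tau> (set l) (set l')" by simp
    have "bij_betw \<tau> ({1..n} - set l) ({1..n} - set l') = bij_betw g ({1..n} - set l) ({1..n} - set l')"
      by (rule bij_betw_cong) (auto simp: \<tau>_def)
    with bij2 show "bij_betw \<tau> ({1..n} - set l) ({1..n} - set l')" by simp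
  qed auto
  then have "bij_betw \<tau> {1..n} {1..n}" using sub by (simp add: Un_absorb1)
  then have "\<tau> \<in> sym_set n"
    unfolding sym_group_carrier by (rule bij_imp_permutes) (auto simp: \<tau>_def)
  moreover have "map \<tau> l = l'"
  proof (rule nth_equalityI)
    fix i assume "i < length (map \<tau> l)"
    moreover from this sub have "l ! i \<in> {1..n}" using nth_mem by fastforce
    ultimately show "map \<tau> l ! i = l' ! i" by (simp add: \<tau>_def h)
  qed (simp add: len)
  ultimately show ?thesis by (rule that)
qed

text \<open>A complete invariant of pairs of tuples under the diagonal action. As a subset of a
  \<open>k\<close> by \<open>k\<close> grid it takes at most \<open>2 ^ (k * k)\<close>
  values.\<close>

definition pattern :: "nat \<Rightarrow> nat list \<Rightarrow> nat list \<Rightarrow> (nat \<times> nat) set" where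
  "pattern k x y = {(i, j). i < k \<and> j < k \<and> x ! i = y ! j}"

text \<open>Concatenation reduces the pair to a single list: coincidences inside each half are
  settled by distinctness, those across the halves by the pattern.\<close>

lemma exists_sym_map_pattern:
  assumes xy: "x \<in> tuples n k" "y \<in> tuples n k" "x' \<in> tuples n k" "y' \<in> tuples n k"
    and pat: "pattern k x y = pattern k x' y'"
  obtains \<tau> where "\<tau> \<in> sym_set n" "map \<tau> x = x'" "map \<tau> y = y'"
proof -
  have len: "length x = k" "length y = k" "length x' = k" "length y' = k"
    using xy by (auto simp: tuples_def)
  have cross: "x ! i = y ! j \<longleftrightarrow> x' ! i = y' ! j" if "i < k" "j < k" for i j
    using pat that by (auto simp: pattern_def set_eq_iff)
  obtain \<tau> where \<tau>: "\<tau> \<in> sym_set n" "map \<tau> (x @ y) = x' @ y'"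
  proof (rule exists_sym_map_eq)
    show "length (x @ y) = length (x' @ y')" using len by simp
    show "set (x @ y) \<subseteq> {1..n}" "set (x' @ y') \<subseteq> {1..n}" using xy by (auto simp: tuples_def)
    fix i j assume ij: "i < length (x @ y)" "j < length (x @ y)"
    have d: "distinct x" "distinct y" "distinct x'" "distinct y'" using xy by (auto simp: tuples_def)
    show "(x @ y) ! i = (x @ y) ! j \<longleftrightarrow> (x' @ y') ! i = (x' @ y') ! j"
    proof (cases "i < k")
      case i: True
      show ?thesis
      proof (cases "j < k")
        case True
        with i len d show ?thesis by (simp add: nth_append nth_eq_iff_index_eq)
      next
        case False
        with i ij len cross[of i "j - k"] show ?thesis by (simp add: nth_append)
      qed
    next
      case i: False
      show ?thesis
      proof (cases "j < k")
        case True
        with i ij len cross[of j "i - k"] have "x ! j = y ! (i - k) \<longleftrightarrow> x' ! j = y' ! (i - k)"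
          by simp
        with True i ij len show ?thesis by (auto simp: nth_append)
      next
        case False
        with i ij len d show ?thesis by (simp add: nth_append nth_eq_iff_index_eq)
      qed
    qed
  qed
  then have "map \<tau> x = x' \<and> map \<tau> y = y'" using len by simp
  with \<tau>(1) show ?thesis using that by blast
qed

text \<open>An odd solution is corrected by the transposition of two points outside
  \<open>x'\<close>, which \<open>k + 2 \<le> n\<close> provides.\<close>

lemma exists_even_sym_map_eq:
  assumes x: "x \<in> tuples n k" "x' \<in> tuples n k" and n: "k + 2 \<le> n"
  obtains \<tau> where "\<tau> \<in> sym_set n" "evenperm \<tau>" "map \<tau> x = x'"
proof -
  have len: "length x = k" "length x' = k" "distinct x" "distinct x'"
    and sub: "set x \<subseteq> {1..n}" "set x' \<subseteq> {1..n}"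
    using x by (auto simp: tuples_def)
  obtain \<tau> where \<tau>: "\<tau> \<in> sym_set n" "map \<tau> x = x'"
    using exists_sym_map_eq[of x x' n] len sub by (auto simp: nth_eq_iff_index_eq)
  have "card ({1..n} - set x') \<ge> 2"
    using n len sub by (simp add: card_Diff_subset distinct_card)
  then obtain a b where ab: "a \<in> {1..n} - set x'" "b \<in> {1..n} - set x'" "a \<noteq> b"
    by (metis card_2_iff' card_le_Suc_iff numeral_2_eq_2 obtain_subset_with_card_n subset_eq)
  show ?thesis
  proof (cases "evenperm \<tau>")
    case True
    with \<tau> show ?thesis by (intro that)
  next
    case False
    let ?t = "transpose a b"
    have t: "?t \<in> sym_set n" using ab by (auto simp: sym_group_carrier intro: permutes_swap_id)
    have "\<not> evenperm ?t" using ab by (simp add: evenperm_swap)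
    with False t \<tau> have "evenperm (?t \<circ> \<tau>)" by (simp add: evenperm_comp_sym)
    moreover have "map (?t \<circ> \<tau>) x = x'"
    proof -
      have "map ?t x' = x'" using ab by (intro map_idI) (auto simp: transpose_def)
      then show ?thesis using \<tau>(2) by (simp flip: map_map)
    qed
    ultimately show ?thesis using t \<tau> by (intro that[of "?t \<circ> \<tau>"]) auto
  qed
qed

text \<open>The even permutations are transitive on tuples, and their indicator function is
  invariant under even translations from both sides. So row and column can be moved independently of
  each other.\<close>

lemma rho_tuples_even_const:
  assumes n: "k + 2 \<le> n"
    and tup: "x \<in> tuples n k" "y \<in> tuples n k" "x' \<in> tuples n k" "y' \<in> tuples n k"
  shows "rho_tuples n (\<lambda>\<sigma>. if evenperm \<sigma> then M else 0) x y =
    rho_tuples n (\<lambda>\<sigma>. if evenperm \<sigma> then M else 0) x' y'"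
proof -
  define e where "e \<sigma> = (if evenperm \<sigma> then M else 0)" for \<sigma> :: "nat \<Rightarrow> nat"
  obtain \<tau> where \<tau>: "\<tau> \<in> sym_set n" "evenperm \<tau>" "map \<tau> x = x'"
    using exists_even_sym_map_eq[OF tup(1,3) n] .
  obtain \<pi> where \<pi>: "\<pi> \<in> sym_set n" "evenperm \<pi>" "map \<pi> y' = y"
    using exists_even_sym_map_eq[OF tup(4,2) n] .
  have "rho_tuples n e x' y' = (\<Sum>\<sigma>\<in>sym_set n. e (\<tau> \<circ> \<sigma> \<circ> \<pi>) * perm_matrix (\<tau> \<circ> \<sigma> \<circ> \<pi>) x' y')"
    unfolding rho_tuples_def
    by (simp add: sum_sym_left[OF \<tau>(1), where F = "\<lambda>\<sigma>. e (\<sigma> \<circ> \<pi>) * perm_matrix (\<sigma> \<circ> \<pi>) x' y'"]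
        sum_sym_right[OF \<pi>(1), where F = "\<lambda>\<sigma>. e \<sigma> * perm_matrix \<sigma> x' y'"])
  also have "\<dots> = rho_tuples n e x y"
    unfolding rho_tuples_def
  proof (intro sum.cong refl)
    fix \<sigma> assume s: "\<sigma> \<in> sym_set n"
    have "e (\<tau> \<circ> \<sigma> \<circ> \<pi>) = e \<sigma>"
      using s \<tau> \<pi> by (simp add: e_def evenperm_comp_sym[where n = n])
    moreover have "perm_matrix (\<tau> \<circ> \<sigma> \<circ> \<pi>) x' y' = perm_matrix \<sigma> x y"
      by (simp add: perm_matrix_def \<tau>(3)[symmetric] \<pi>(3)[symmetric] map_sym_inject[OF \<tau>(1)]
          del: map_map flip: map_map)
    ultimately show "e (\<tau> \<circ> \<sigma> \<circ> \<pi>) * perm_matrix (\<tau> \<circ> \<sigma> \<circ> \<pi>) x' y' = e \<sigma> * perm_matrix \<sigma> x y"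
      by simp
  qed
  finally show ?thesis unfolding e_def by simp
qed

text \<open>Reindexing by conjugation with \<open>\<tau>\<close> leaves the coefficients of a class
  function unchanged. Hence an entry depends only on the orbit of the pair, that is, on its
  pattern.\<close>

lemma rho_tuples_normal_map:
  assumes nrm: "normal_elem n h" and t: "\<tau> \<in> sym_set n"
  shows "rho_tuples n h (map \<tau> x) (map \<tau> y) = rho_tuples n h x y"
proof -
  have "rho_tuples n h (map \<tau> x) (map \<tau> y) =
    (\<Sum>\<sigma>\<in>sym_set n. h (\<tau> \<circ> \<sigma> \<circ> inv' \<tau>) * perm_matrix (\<tau> \<circ> \<sigma> \<circ> inv' \<tau>) (map \<tau> x) (map \<tau> y))"
    unfolding rho_tuples_def
    by (simp add: sum_sym_left[OF t, where F = "\<lambda>\<sigma>. h (\<sigma> \<circ> inv' \<tau>) * perm_matrix (\<sigma> \<circ> inv' \<tau>) (map \<tau> x) (map \<tau> y)"]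
        sum_sym_right[OF inv_in_sym[OF t], where F = "\<lambda>\<sigma>. h \<sigma> * perm_matrix \<sigma> (map \<tau> x) (map \<tau> y)"])
  also have "\<dots> = rho_tuples n h x y"
    unfolding rho_tuples_def
  proof (intro sum.cong refl)
    fix \<sigma> assume s: "\<sigma> \<in> sym_set n"
    have "map (\<tau> \<circ> \<sigma> \<circ> inv' \<tau>) (map \<tau> y) = map \<tau> (map \<sigma> y)"
      using t by (simp only: map_map comp_inv_comp_sym)
    then show "h (\<tau> \<circ> \<sigma> \<circ> inv' \<tau>) * perm_matrix (\<tau> \<circ> \<sigma> \<circ> inv' \<tau>) (map \<tau> x) (map \<tau> y) =
      h \<sigma> * perm_matrix \<sigma> x y"
      using nrm s t by (simp add: normal_elem_iff perm_matrix_def map_sym_inject[OF t] del: map_map)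
  qed
  finally show ?thesis .
qed

section \<open>Class functions of the number of moved points\<close>

text \<open>A conjugation invariant that takes every value from 3 to \<open>n\<close> on even
  permutations, and so supplies \<open>n - 2\<close> independent class functions.\<close>

definition num_moved :: "nat \<Rightarrow> (nat \<Rightarrow> nat) \<Rightarrow> nat" where
  "num_moved n \<sigma> = card {i \<in> {1..n}. \<sigma> i \<noteq> i}"

lemma num_moved_conj:
  assumes s: "\<sigma> \<in> sym_set n" and t: "\<tau> \<in> sym_set n"
  shows "num_moved n (\<tau> \<circ> \<sigma> \<circ> inv' \<tau>) = num_moved n \<sigma>"
proof -
  have p: "\<tau> permutes {1..n}" using t by (simp add: sym_group_carrier)
  have inv: "inv' \<tau> (\<tau> i) = i" "\<tau> (inv' \<tau> i) = i" for i
    using permutes_inverses[OF p] by auto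
  have "{i \<in> {1..n}. (\<tau> \<circ> \<sigma> \<circ> inv' \<tau>) i \<noteq> i} = \<tau> ` {i \<in> {1..n}. \<sigma> i \<noteq> i}"
  proof (intro equalityI subsetI)
    fix i assume i: "i \<in> {i \<in> {1..n}. (\<tau> \<circ> \<sigma> \<circ> inv' \<tau>) i \<noteq> i}"
    then have "inv' \<tau> i \<in> {i \<in> {1..n}. \<sigma> i \<noteq> i}"
      using permutes_in_image[OF permutes_inv[OF p], of i] inv by (auto simp: comp_def)
    then show "i \<in> \<tau> ` {i \<in> {1..n}. \<sigma> i \<noteq> i}" by (rule rev_image_eqI) (simp add: inv)
  next
    fix i assume "i \<in> \<tau> ` {i \<in> {1..n}. \<sigma> i \<noteq> i}"
    then show "i \<in> {i \<in> {1..n}. (\<tau> \<circ> \<sigma> \<circ> inv' \<tau>) i \<noteq> i}"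
      using permutes_in_image[OF p] inv by (auto simp: comp_def) (metis inv(1))+
  qed
  then show ?thesis
    using permutes_inj_on[OF p] by (simp add: num_moved_def card_image)
qed

lemma num_moved_inv:
  assumes "\<sigma> \<in> sym_set n"
  shows "num_moved n (inv' \<sigma>) = num_moved n \<sigma>"
proof -
  have "inv' \<sigma> i = i \<longleftrightarrow> \<sigma> i = i" for i
    using assms permutes_inverses[of \<sigma> "{1..n}"] by (metis sym_group_carrier)
  then show ?thesis by (simp add: num_moved_def)
qed

lemma normal_elem_num_moved:
  "normal_elem n (\<lambda>\<sigma>. if evenperm \<sigma> then b (num_moved n \<sigma>) else 0)"
  by (auto simp: normal_elem_iff num_moved_conj evenperm_comp_sym[where n = n] evenperm_inv_sym[where n = n])

text \<open>The cycle on the points from 1 to \<open>m\<close>, fixing everything else.\<close>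

definition rot :: "nat \<Rightarrow> nat \<Rightarrow> nat" where
  "rot m i = (if i = m then 1 else if 1 \<le> i \<and> i < m then i + 1 else i)"

lemma rot_in_sym:
  assumes "1 \<le> m" "m \<le> n"
  shows "rot m \<in> sym_set n"
proof -
  have "bij_betw (rot m) {1..m} {1..m}"
    by (rule bij_betwI[of _ _ _ "\<lambda>i. if i = 1 then m else i - 1"]) (use assms in \<open>auto simp: rot_def\<close>)
  then have "rot m permutes {1..m}" by (rule bij_imp_permutes) (use assms in \<open>auto simp: rot_def\<close>)
  then show ?thesis unfolding sym_group_carrier by (rule permutes_subset) (use assms in auto)
qed

text \<open>Squaring makes the cycle even without any computation of signs.\<close>

lemma exists_even_num_moved:
  assumes "3 \<le> m" "m \<le> n"
  obtains \<sigma> where "\<sigma> \<in> sym_set n" "evenperm \<sigma>" "num_moved n \<sigma> = m"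
proof -
  have r: "rot m \<in> sym_set n" using assms by (intro rot_in_sym) auto
  \<comment> \<open>Two steps along a cycle of length at least 3 never return to the start, so the
    square moves the same \<open>m\<close> points.\<close>
  have "{i \<in> {1..n}. (rot m \<circ> rot m) i \<noteq> i} = {1..m}"
    using assms by (auto simp: rot_def split: if_splits)
  then have "num_moved n (rot m \<circ> rot m) = m" unfolding num_moved_def by simp
  with r show ?thesis by (intro that[of "rot m \<circ> rot m"]) (auto simp: evenperm_comp_sym)
qed

text \<open>There are \<open>n - 2\<close> unknown values of \<open>b\<close> and one linear
  equation for each of the \<open>2 ^ (k * k)\<close> possible patterns, so the bound on
  \<open>n\<close> leaves a nontrivial solution.\<close>

lemma exists_annihilating_class_function:
  assumes n: "2 ^ (k * k) + 3 \<le> n"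
  obtains b where "\<exists>m\<in>{3..n}. b m \<noteq> 0"
    "\<And>x y. x \<in> tuples n k \<Longrightarrow> y \<in> tuples n k \<Longrightarrow>
      rho_tuples n (\<lambda>\<sigma>. if evenperm \<sigma> then b (num_moved n \<sigma>) else 0) x y = 0"
proof -
  define G where "G m = (\<lambda>\<sigma>. if evenperm \<sigma> then (if num_moved n \<sigma> = m then 1 else 0) else 0 :: real)" for m
  have nG: "normal_elem n (G m)" for m
    unfolding G_def by (rule normal_elem_num_moved[of n "\<lambda>j. if j = m then 1 else 0"])
  \<comment> \<open>A representative pair for each pattern. For a set that is no pattern of tuples
    the choice is arbitrary, which merely adds an equation already counted.\<close>
  define r where "r p = (SOME q. case q of (x, y) \<Rightarrow>
    x \<in> tuples n k \<and> y \<in> tuples n k \<and> pattern k x y = p)" for p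
  let ?P = "Pow ({..<k} \<times> {..<k})"
  have "card ?P < card {3..n}" using n by (simp add: card_Pow card_cartesian_product)
  then obtain c :: "nat \<Rightarrow> real" where c: "\<exists>m\<in>{3..n}. c m \<noteq> 0"
    "\<forall>p\<in>?P. (\<Sum>m\<in>{3..n}. c m * rho_tuples n (G m) (fst (r p)) (snd (r p))) = 0"
    using exists_nontrivial_relation[of ?P "{3..n}" "\<lambda>m p. rho_tuples n (G m) (fst (r p)) (snd (r p))"]
    by auto
  \<comment> \<open>The value 0 outside \<open>{3..n}\<close> matches the range of the sum; in
    particular the identity gets coefficient 0.\<close>
  define b where "b m = (if m \<in> {3..n} then c m else 0)" for m
  show ?thesis
  proof (rule that[of b])
    show "\<exists>m\<in>{3..n}. b m \<noteq> 0" using c(1) by (auto simp: b_def)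
    fix x y assume xy: "x \<in> tuples n k" "y \<in> tuples n k"
    obtain x' y' where r: "r (pattern k x y) = (x', y')" by fastforce
    have "case r (pattern k x y) of (x', y') \<Rightarrow>
      x' \<in> tuples n k \<and> y' \<in> tuples n k \<and> pattern k x' y' = pattern k x y"
      unfolding r_def by (rule someI[of _ "(x, y)"]) (use xy in auto)
    then have r': "x' \<in> tuples n k" "y' \<in> tuples n k" "pattern k x' y' = pattern k x y"
      unfolding r by auto
    obtain \<tau> where \<tau>: "\<tau> \<in> sym_set n" "map \<tau> x' = x" "map \<tau> y' = y"
      using exists_sym_map_pattern[OF r'(1,2) xy r'(3)] .
    have "rho_tuples n (\<lambda>\<sigma>. if evenperm \<sigma> then b (num_moved n \<sigma>) else 0) x y =
      (\<Sum>\<sigma>\<in>sym_set n. \<Sum>m\<in>{3..n}. c m * (G m \<sigma> * perm_matrix \<sigma> x y))"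
      unfolding rho_tuples_def
    proof (intro sum.cong refl)
      fix \<sigma>
      have "(\<Sum>m\<in>{3..n}. c m * (G m \<sigma> * perm_matrix \<sigma> x y)) =
        (\<Sum>m\<in>{3..n}. if m = num_moved n \<sigma> then c m * (if evenperm \<sigma> then 1 else 0) * perm_matrix \<sigma> x y else 0)"
        by (intro sum.cong) (auto simp: G_def)
      then show "(if evenperm \<sigma> then b (num_moved n \<sigma>) else 0) * perm_matrix \<sigma> x y =
        (\<Sum>m\<in>{3..n}. c m * (G m \<sigma> * perm_matrix \<sigma> x y))"
        by (simp add: b_def)
    qed
    also have "\<dots> = (\<Sum>m\<in>{3..n}. c m * rho_tuples n (G m) x y)"
      by (subst sum.swap) (simp add: rho_tuples_def sum_distrib_left)
    \<comment> \<open>Passing to the representative of the pattern, for which the equation was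
      imposed.\<close>
    also have "\<dots> = (\<Sum>m\<in>{3..n}. c m * rho_tuples n (G m) x' y')"
      unfolding \<tau>(2,3)[symmetric] rho_tuples_normal_map[OF nG \<tau>(1)] ..
    also have "\<dots> = 0"
    proof -
      have "pattern k x y \<in> ?P" by (auto simp: pattern_def)
      with c(2) have "(\<Sum>m\<in>{3..n}. c m * rho_tuples n (G m) (fst (r (pattern k x y))) (snd (r (pattern k x y)))) = 0"
        by (rule bspec)
      then show ?thesis unfolding r by simp
    qed
    finally show "rho_tuples n (\<lambda>\<sigma>. if evenperm \<sigma> then b (num_moved n \<sigma>) else 0) x y = 0" .
  qed
qed

text \<open>Each column of a permutation matrix contains a single 1, so a column of
  \<open>rho_tuples n f\<close> sums to the coefficient sum of \<open>f\<close>.\<close>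

lemma sum_eq_zero_if_rho_tuples_eq_zero:
  assumes y: "y \<in> tuples n k" and zero: "\<And>x. x \<in> tuples n k \<Longrightarrow> rho_tuples n f x y = 0"
  shows "(\<Sum>\<sigma>\<in>sym_set n. f \<sigma>) = 0"
proof -
  have "(\<Sum>x\<in>tuples n k. rho_tuples n f x y) =
    (\<Sum>\<sigma>\<in>sym_set n. \<Sum>x\<in>tuples n k. f \<sigma> * perm_matrix \<sigma> x y)"
    unfolding rho_tuples_def by (rule sum.swap)
  also have "\<dots> = (\<Sum>\<sigma>\<in>sym_set n. f \<sigma>)"
    using map_in_tuples[OF _ y] by (intro sum.cong refl) (simp add: perm_matrix_def flip: sum_distrib_left)
  finally show ?thesis using zero by simp
qed

section \<open>Construction of the element and comparison of the eigenvalues\<close>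

theorem theorem1p9:
  fixes k :: nat
  assumes "1 \<le> k"
  shows "\<exists>n0. \<forall>n \<ge> n0. \<exists>\<alpha> :: (nat \<Rightarrow> nat) \<Rightarrow> real.
           nonneg_elem n \<alpha> \<and> normal_elem n \<alpha> \<and>
           max (lambda_tuples n k \<alpha>) (lambda_sgn_tuples n k \<alpha>) < lambda_Sn n \<alpha>"
\<comment> \<open>The threshold covers both the count of patterns and the two spare points that make
  even permutations transitive on tuples.\<close>
proof (rule exI[of _ "2 ^ (k * k) + 3 + k"], intro allI impI)
  fix n :: nat assume "2 ^ (k * k) + 3 + k \<le> n"
  then have n: "2 ^ (k * k) + 3 \<le> n" "k + 2 \<le> n" by auto
  obtain b :: "nat \<Rightarrow> real" where b: "\<exists>m\<in>{3..n}. b m \<noteq> 0" and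
    ann: "\<And>x y. x \<in> tuples n k \<Longrightarrow> y \<in> tuples n k \<Longrightarrow>
      rho_tuples n (\<lambda>\<sigma>. if evenperm \<sigma> then b (num_moved n \<sigma>) else 0) x y = 0"
    using exists_annihilating_class_function[OF n(1)] by metis
  define f where "f \<sigma> = (if evenperm \<sigma> then b (num_moved n \<sigma>) else 0)" for \<sigma>
  have rf: "rho_tuples n f x y = 0" if "x \<in> tuples n k" "y \<in> tuples n k" for x y
    unfolding f_def using ann[OF that] .
  have t1: "[1..<k + 1] \<in> tuples n k" using n by (auto simp: tuples_def)
  have t2: "[2..<k + 2] \<in> tuples n k" using n by (auto simp: tuples_def)
  \<comment> \<open>This is where \<open>1 \<le> k\<close> enters: the first entries are 1 and 2,
    whereas for \<open>k = 0\<close> there is only the empty tuple.\<close>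
  have t12: "[1..<k + 1] \<noteq> [2..<k + 2]"
    using assms by (auto simp: upt_rec)
  have nf: "normal_elem n f" unfolding f_def by (rule normal_elem_num_moved)
  obtain m where m: "m \<in> {3..n}" "b m \<noteq> 0" using b by auto
  then obtain \<sigma>0 where \<sigma>0: "\<sigma>0 \<in> sym_set n" "evenperm \<sigma>0" "num_moved n \<sigma>0 = m"
    using exists_even_num_moved[of m n] by auto
  obtain s :: real where s: "\<bar>s\<bar> = 1"
    and pos: "\<And>M. 0 < lambda_Sn n (\<lambda>\<sigma>. (if evenperm \<sigma> then M else 0) + s * f \<sigma>)"
  proof (rule lambda_Sn_pos[OF nf])
    show "f (inv' \<sigma>) = f \<sigma>" if "\<sigma> \<in> sym_set n" for \<sigma>
      using that by (simp add: f_def num_moved_inv evenperm_inv_sym[where n = n])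
    show "\<sigma>0 \<in> sym_set n" "f \<sigma>0 \<noteq> 0" using \<sigma>0 m by (auto simp: f_def)
    show "(\<Sum>\<sigma>\<in>sym_set n. f \<sigma>) = 0"
      using rf t1 by (intro sum_eq_zero_if_rho_tuples_eq_zero[of "[1..<k + 1]" n k]) auto
  qed (auto simp: f_def)
  \<comment> \<open>Large enough to dominate each value of \<open>f\<close>, whichever sign
    \<open>s\<close> has.\<close>
  define M where "M = (\<Sum>\<sigma>\<in>sym_set n. \<bar>f \<sigma>\<bar>)"
  define \<alpha> where "\<alpha> \<sigma> = (if evenperm \<sigma> then M else 0) + s * f \<sigma>" for \<sigma>
  have nonneg: "nonneg_elem n \<alpha>"
    unfolding nonneg_elem_def
  proof
    fix \<sigma> assume "\<sigma> \<in> sym_set n"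
    then have "\<bar>f \<sigma>\<bar> \<le> M" unfolding M_def by (intro member_le_sum) auto
    moreover have "\<bar>s * f \<sigma>\<bar> = \<bar>f \<sigma>\<bar>" using s by (simp add: abs_mult)
    ultimately show "0 \<le> \<alpha> \<sigma>" by (cases "evenperm \<sigma>") (auto simp: \<alpha>_def f_def)
  qed
  \<comment> \<open>The element has the same shape as \<open>f\<close>, with \<open>b m\<close>
    replaced by \<open>M + s * b m\<close>.\<close>
  have normal: "normal_elem n \<alpha>"
    using normal_elem_num_moved[of n "\<lambda>m. M + s * b m"]
    by (auto simp: normal_elem_def \<alpha>_def f_def if_distrib cong: if_cong)
  let ?\<kappa> = "rho_tuples n (\<lambda>\<sigma>. if evenperm \<sigma> then M else 0) [1..<k + 1] [1..<k + 1]"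
  have const: "rho_tuples n \<alpha> x y = ?\<kappa>" if "x \<in> tuples n k" "y \<in> tuples n k" for x y
  proof -
    have "rho_tuples n \<alpha> x y =
      rho_tuples n (\<lambda>\<sigma>. if evenperm \<sigma> then M else 0) x y + s * rho_tuples n f x y"
      unfolding rho_tuples_def \<alpha>_def
      by (simp add: distrib_right sum.distrib sum_distrib_left mult.assoc)
    also have "\<dots> = ?\<kappa>"
      using rf[OF that] rho_tuples_even_const[OF n(2) that t1 t1] by simp
    finally show ?thesis .
  qed
  have "lambda_tuples n k \<alpha> = 0"
    unfolding lambda_tuples_def
    using max_eigenvalue_orth_const_const[OF finite_tuples t1 t2 t12] const by blast
  \<comment> \<open>The sign twist changes nothing because \<open>\<alpha>\<close> vanishes on odd
    permutations.\<close>
  moreover have "rho_sgn_tuples n \<alpha> = rho_tuples n \<alpha>"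
    unfolding rho_sgn_tuples_def rho_tuples_def
    by (intro ext sum.cong) (auto simp: \<alpha>_def f_def sign_def)
  then have "lambda_sgn_tuples n k \<alpha> = lambda_tuples n k \<alpha>"
    by (simp add: lambda_sgn_tuples_def lambda_tuples_def)
  moreover have "0 < lambda_Sn n \<alpha>" unfolding \<alpha>_def by (rule pos)
  ultimately show "\<exists>\<alpha>. nonneg_elem n \<alpha> \<and> normal_elem n \<alpha> \<and>
      max (lambda_tuples n k \<alpha>) (lambda_sgn_tuples n k \<alpha>) < lambda_Sn n \<alpha>"
    using nonneg normal by (intro exI[of _ \<alpha>]) simp
qed

end
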